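(* Let $X$ be an infinite dimensional complex Banach space and let $T \in L(X)$. The following statements are equivalent: (i) Browder's theorem holds for $T$; (ii) $\mathrm{int}\, \sigma_{desc}(T) \subset \sigma_w(T)$; (iii) $\mathrm{int}\, \sigma_{su}(T) \subset \sigma_w(T)$; (iv) $\mathrm{int}\, \sigma_{ap}(T) \subset \sigma_w(T)$. In particular, if either $\sigma_{ap}(T)$ or $\sigma_{su}(T)$ has no interior points then Browder's theorem holds for $T$.
   Context: $L(X)$ is the algebra of bounded linear operators on $X$, and $\mathrm{int}\,F$ is the interior of $F\subset\mathbb{C}$. For $S\in L(X)$, $N(S)$ and $R(S)$ are the null space and range, $\alpha(S)=\dim N(S)$, $\beta(S)=\mathrm{codim}\,R(S)$. $S$ is bounded below if it is injective with closed range. $S$ is Fredholm if $R(S)$ is closed, $\alpha(S)<\infty$ and $\beta(S)<\infty$; then $\mathrm{ind}(S)=\alpha(S)-\beta(S)$. $S$ is Weyl if it is Fredholm with $\mathrm{ind}(S)=0$. The ascent $p(S)$ is the smallest integer $p\ge 0$ with $N(S^p)=N(S^{p+1})$ ($\infty$ if none exists); the descent $q(S)$ is the smallest integer $q\ge 0$ with $R(S^q)=R(S^{q+1})$ ($\infty$ if none exists). $S$ is Browder if it is Fredholm with $p(S)<\infty$ and $q(S)<\infty$. The spectra are the sets of $\lambda\in\mathbb{C}$ such that: $T-\lambda I$ is not bounded below ($\sigma_{ap}(T)$); $R(T-\lambda I)\ne X$ ($\sigma_{su}(T)$); $T-\lambda I$ is not Weyl ($\sigma_w(T)$); $T-\lambda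 I$ is not Browder ($\sigma_b(T)$); $q(T-\lambda I)=\infty$ ($\sigma_{desc}(T)$). Browder's theorem holds for $T$ if $\sigma_w(T)=\sigma_b(T)$. *)

theory Defs
  imports "HOL-Analysis.Analysis" "HOL-Library.Extended_Nat"
begin

text \<open>
  HOL-Analysis has only real normed spaces as type classes. A complex normed space is a real
  normed space with a compatible complex scalar multiplication.
\<close>

class complex_normed_vector = real_normed_vector +
  fixes scaleC :: "complex \<Rightarrow> 'a \<Rightarrow> 'a" (infixr "*\<^sub>C" 75)
  assumes scaleC_add_right: "c *\<^sub>C (x + y) = c *\<^sub>C x + c *\<^sub>C y"
    and scaleC_add_left: "(c + d) *\<^sub>C x = c *\<^sub>C x + d *\<^sub>C x"
    and scaleC_scaleC: "c *\<^sub>C (d *\<^sub>C x) = (c * d) *\<^sub>C x"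
    and scaleC_one: "1 *\<^sub>C x = x"
    and scaleR_scaleC: "r *\<^sub>R x = complex_of_real r *\<^sub>C x"
    and norm_scaleC: "norm (c *\<^sub>C x) = cmod c * norm x"

class complex_banach = complex_normed_vector + banach

global_interpretation complex_vector:
  vector_space "scaleC :: complex \<Rightarrow> 'a \<Rightarrow> 'a::complex_normed_vector"
  by unfold_locales (rule scaleC_add_right scaleC_add_left scaleC_scaleC scaleC_one)+

text \<open>
  The library's \<open>dim\<close> is \<open>0\<close> on spaces that are not finitely generated; here these get
  dimension \<open>\<infinity>\<close>.
\<close>

definition cdim :: "'a::complex_normed_vector set \<Rightarrow> enat" where
  "cdim V = (if \<exists>B. finite B \<and> V \<subseteq> complex_vector.span B
             then enat (complex_vector.dim V) else \<infinity>)"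

text \<open>
  For finite \<open>B\<close>, \<open>independent_mod M B\<close> says that the cosets \<open>b + M\<close>, \<open>b \<in> B\<close>, are distinct and linearly
  independent in the quotient space modulo the subspace \<open>M\<close>; \<open>codim M\<close> is the dimension of that
  quotient, that is, the supremum of the sizes of its finite linearly independent families.
\<close>

definition independent_mod :: "'a::complex_normed_vector set \<Rightarrow> 'a set \<Rightarrow> bool" where
  "independent_mod M B \<longleftrightarrow> (\<forall>c. (\<Sum>b\<in>B. c b *\<^sub>C b) \<in> M \<longrightarrow> (\<forall>b\<in>B. c b = 0))"

definition codim :: "'a::complex_normed_vector set \<Rightarrow> enat" where
  "codim M = Sup {enat (card B) | B. finite B \<and> independent_mod M B}"

text \<open>
  \<open>codim M\<close> is also the dimension of any algebraic complement of \<open>M\<close>.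
\<close>

lemma codim_eq_cdim_complement:
  fixes M W :: "'a::complex_normed_vector set"
  assumes M: "complex_vector.subspace M" and W: "complex_vector.subspace W"
    and MW: "M \<inter> W = {0}" and ex: "\<And>x. \<exists>m\<in>M. \<exists>w\<in>W. x = m + w"
  shows "codim M = cdim W"
proof -
  have indep_W: "independent_mod M B"
    if "finite B" "B \<subseteq> W" "complex_vector.independent B" for B
    unfolding independent_mod_def
  proof (intro allI impI)
    fix c assume "(\<Sum>b\<in>B. c b *\<^sub>C b) \<in> M"
    moreover have "(\<Sum>b\<in>B. c b *\<^sub>C b) \<in> W"
      using that by (intro complex_vector.subspace_sum[OF W] complex_vector.subspace_scale[OF W]) auto
    ultimately have "(\<Sum>b\<in>B. c b *\<^sub>C b) = 0" using MW by auto
    then show "\<forall>b\<in>B. c b = 0"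
      using complex_vector.independentD[OF that(3,1)] by auto
  qed
  have to_W: "\<exists>C. finite C \<and> C \<subseteq> W \<and> complex_vector.independent C \<and> card C = card B"
    if fin: "finite B" and ind: "independent_mod M B" for B
  proof -
    from ex have "\<forall>x. \<exists>w. w \<in> W \<and> x - w \<in> M" by (metis add_diff_cancel_right')
    then obtain f where f: "\<And>x. f x \<in> W" "\<And>x. x - f x \<in> M" by metis
    have key: "\<forall>b\<in>B. c b = 0" if "(\<Sum>b\<in>B. c b *\<^sub>C f b) = 0" for c
    proof -
      have "(\<Sum>b\<in>B. c b *\<^sub>C (b - f b)) \<in> M"
        using f(2) by (intro complex_vector.subspace_sum[OF M] complex_vector.subspace_scale[OF M]) auto
      then have "(\<Sum>b\<in>B. c b *\<^sub>C b) \<in> M"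
        using that by (simp add: complex_vector.scale_right_diff_distrib sum_subtractf)
      then show ?thesis using ind by (auto simp: independent_mod_def)
    qed
    have inj: "inj_on f B"
    proof (rule inj_onI, rule ccontr)
      fix x y assume xy: "x \<in> B" "y \<in> B" "f x = f y" "x \<noteq> y"
      define c where "c b = (if b = x then 1 else if b = y then - 1 else (0::complex))" for b
      have "(\<Sum>b\<in>B. c b *\<^sub>C f b) = (\<Sum>b\<in>{x,y}. c b *\<^sub>C f b)"
        using xy fin by (intro sum.mono_neutral_right) (auto simp: c_def)
      also have "\<dots> = 0" using xy by (simp add: c_def)
      finally show False using key[of c] xy by (auto simp: c_def)
    qed
    have "complex_vector.independent (f ` B)"
    proof (rule complex_vector.independent_if_scalars_zero)
      fix u x assume u: "(\<Sum>x\<in>f ` B. u x *\<^sub>C x) = 0" and "x \<in> f ` B"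
      then show "u x = 0"
        using key[of "u \<circ> f"] by (auto simp: sum.reindex[OF inj])
    qed (use fin in auto)
    then show ?thesis using f fin card_image[OF inj] by (intro exI[of _ "f ` B"]) auto
  qed
  obtain C where C: "C \<subseteq> W" "complex_vector.independent C" "W \<subseteq> complex_vector.span C"
    "card C = complex_vector.dim W"
    using complex_vector.basis_exists[of W] by metis
  show ?thesis
  proof (cases "finite C")
    case True
    have "codim M \<le> enat (card C)" unfolding codim_def
    proof (rule Sup_least, safe)
      fix B assume "finite B" "independent_mod M B"
      then obtain D where D: "D \<subseteq> W" "complex_vector.independent D" "card D = card B"
        using to_W by metis
      then have "card D \<le> card C"
        using C(3) complex_vector.independent_span_bound[OF True] by blast
      with D show "enat (card B) \<le> enat (card C)" by simp
    qed
    moreover have "enat (card C) \<le> codim M" unfolding codim_def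
      by (rule Sup_upper) (use indep_W True C in blast)
    ultimately show ?thesis using True C by (auto simp: cdim_def)
  next
    case False
    have "enat n \<le> codim M" for n
    proof -
      obtain D where D: "D \<subseteq> C" "finite D" "card D = n"
        using False infinite_arbitrarily_large by metis
      then have "independent_mod M D"
        using C by (intro indep_W) (auto dest: complex_vector.independent_mono)
      then show ?thesis unfolding codim_def using D by (intro Sup_upper) blast
    qed
    then have "codim M = \<infinity>"
      by (metis Suc_ile_eq enat_ord_simps(4) less_irrefl not_enat_eq)
    moreover have "cdim W = \<infinity>"
      using False C complex_vector.independent_span_bound unfolding cdim_def
      by (meson order_trans)
    ultimately show ?thesis by simp
  qed
qed

definition bounded_clinear :: "('a::complex_normed_vector \<Rightarrow> 'a) \<Rightarrow> bool" where
  "bounded_clinear S \<longleftrightarrow> bounded_linear S \<and> (\<forall>c x. S (c *\<^sub>C x) = c *\<^sub>C S x)"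

definition null_space :: "('a::complex_normed_vector \<Rightarrow> 'a) \<Rightarrow> 'a set" where
  "null_space S = {x. S x = 0}"

definition nullity :: "('a::complex_normed_vector \<Rightarrow> 'a) \<Rightarrow> enat" where
  "nullity S = cdim (null_space S)"

definition defect :: "('a::complex_normed_vector \<Rightarrow> 'a) \<Rightarrow> enat" where
  "defect S = codim (range S)"

definition bounded_below_op :: "('a::complex_normed_vector \<Rightarrow> 'a) \<Rightarrow> bool" where
  "bounded_below_op S \<longleftrightarrow> inj S \<and> closed (range S)"

definition fredholm :: "('a::complex_normed_vector \<Rightarrow> 'a) \<Rightarrow> bool" where
  "fredholm S \<longleftrightarrow> closed (range S) \<and> nullity S < \<infinity> \<and> defect S < \<infinity>"

text \<open>Only meaningful for Fredholm \<open>S\<close>, since \<open>the_enat \<infinity>\<close> is unspecified.\<close>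

definition fredholm_index :: "('a::complex_normed_vector \<Rightarrow> 'a) \<Rightarrow> int" where
  "fredholm_index S = int (the_enat (nullity S)) - int (the_enat (defect S))"

definition weyl :: "('a::complex_normed_vector \<Rightarrow> 'a) \<Rightarrow> bool" where
  "weyl S \<longleftrightarrow> fredholm S \<and> fredholm_index S = 0"

definition ascent :: "('a::complex_normed_vector \<Rightarrow> 'a) \<Rightarrow> enat" where
  "ascent S = (if \<exists>p. null_space (S ^^ p) = null_space (S ^^ Suc p)
               then enat (LEAST p. null_space (S ^^ p) = null_space (S ^^ Suc p)) else \<infinity>)"

definition descent :: "('a::complex_normed_vector \<Rightarrow> 'a) \<Rightarrow> enat" where
  "descent S = (if \<exists>q. range (S ^^ q) = range (S ^^ Suc q)
                then enat (LEAST q. range (S ^^ q) = range (S ^^ Suc q)) else \<infinity>)"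

definition browder :: "('a::complex_normed_vector \<Rightarrow> 'a) \<Rightarrow> bool" where
  "browder S \<longleftrightarrow> fredholm S \<and> ascent S < \<infinity> \<and> descent S < \<infinity>"

definition shifted :: "('a::complex_normed_vector \<Rightarrow> 'a) \<Rightarrow> complex \<Rightarrow> 'a \<Rightarrow> 'a" where
  "shifted T l = (\<lambda>x. T x - l *\<^sub>C x)"

definition ap_spectrum :: "('a::complex_normed_vector \<Rightarrow> 'a) \<Rightarrow> complex set" where
  "ap_spectrum T = {l. \<not> bounded_below_op (shifted T l)}"

definition su_spectrum :: "('a::complex_normed_vector \<Rightarrow> 'a) \<Rightarrow> complex set" where
  "su_spectrum T = {l. range (shifted T l) \<noteq> UNIV}"

definition weyl_spectrum :: "('a::complex_normed_vector \<Rightarrow> 'a) \<Rightarrow> complex set" where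
  "weyl_spectrum T = {l. \<not> weyl (shifted T l)}"

definition browder_spectrum :: "('a::complex_normed_vector \<Rightarrow> 'a) \<Rightarrow> complex set" where
  "browder_spectrum T = {l. \<not> browder (shifted T l)}"

definition desc_spectrum :: "('a::complex_normed_vector \<Rightarrow> 'a) \<Rightarrow> complex set" where
  "desc_spectrum T = {l. descent (shifted T l) = \<infinity>}"

definition browders_theorem_holds :: "('a::complex_normed_vector \<Rightarrow> 'a) \<Rightarrow> bool" where
  "browders_theorem_holds T \<longleftrightarrow> weyl_spectrum T = browder_spectrum T"

end

theory Submission imports Defs begin

text \<open>
  Everything rests on the operators whose nullity and defect are finite and equal. Such a bounded
  \<open>S\<close> is \<open>U - F\<close> with \<open>U\<close> a bounded bijection and \<open>F\<close> of finite rank, and its range is then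
  automatically closed (\<open>index_zero_structure\<close>); conversely every difference of this form has equal
  finite nullity and defect, which is a purely algebraic fact (\<open>bij_minus_finite_rank_imp\<close>). Hence
  the Weyl operators are exactly the bounded operators of this form. The form is stable under
  powers and under adding a small multiple of the identity, and this replaces the general theory of
  the index: a Weyl operator is injective iff it is surjective; all operators \<open>S - c\<close> with small \<open>c\<close>
  are Weyl if \<open>S\<close> is; and since \<open>N(S\<^sup>n)\<close> and \<open>R(S\<^sup>n)\<close> have the same dimension and codimension for
  every \<open>n\<close>, the ascent of a Weyl operator is finite iff its descent is.

  Two facts describe \<open>S - c\<close> for small \<open>c\<close>. If \<open>S\<close> is Browder, then \<open>S - c\<close> is bijective for all small
  \<open>c \<noteq> 0\<close> (\<open>browder_punctured_neighbourhood\<close>): an eigenvector for \<open>c \<noteq> 0\<close> lies in \<open>R(S\<^sup>n)\<close>, where \<open>S\<close> is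
  bounded below. If \<open>S\<close> is Weyl with infinite ascent, then no \<open>S - c\<close> with small \<open>c\<close> is injective
  (\<open>infinite_ascent_imp_eigenvectors\<close>): a nonzero vector of \<open>N(S)\<close> that lies in all ranges \<open>R(S\<^sup>n)\<close> has
  a backward orbit \<open>x\<^sub>0, x\<^sub>1, \<dots>\<close> under \<open>S\<close> of at most geometric growth, and \<open>\<Sum> c\<^sup>k x\<^sub>k\<close> is an
  eigenvector for \<open>c\<close>. So a Weyl operator \<open>S\<close> is Browder iff there are arbitrarily small \<open>c\<close> with
  \<open>S - c\<close> injective.

  The equivalences follow from one principle (\<open>browders_theorem_iff_interior\<close>). Let \<open>X\<close> be a set of
  complex numbers that contains no \<open>l\<close> with \<open>T - l\<close> bijective, and suppose that every \<open>l \<notin> X\<close> with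
  \<open>T - l\<close> Weyl is a limit of points where \<open>T - l\<close> is injective. Then Browder's theorem holds for \<open>T\<close>
  iff the interior of \<open>X\<close> lies in the Weyl spectrum. The three spectra in question are such sets:
  for the approximate point spectrum the limit condition is trivial, for the surjectivity spectrum
  it says that surjective Weyl operators are injective, and for the descent spectrum it combines
  the finiteness of the ascent with the statement on Browder operators.

  The analytic input consists of the Hahn-Banach theorem, in the form that a finite independent set
  has a dual family of bounded functionals, and of the open mapping theorem for operators between
  closed subspaces.
\<close>

section \<open>Finite-dimensional subspaces and complex linear maps\<close>

abbreviation clinear :: "('a::complex_normed_vector \<Rightarrow> 'a) \<Rightarrow> bool" where
  "clinear \<equiv> Vector_Spaces.linear scaleC scaleC"

global_interpretation complex_pair:
  vector_space_pair "scaleC :: complex \<Rightarrow> 'a \<Rightarrow> 'a::complex_normed_vector"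
    "scaleC :: complex \<Rightarrow> 'a \<Rightarrow> 'a"
  by unfold_locales

lemmas clinear_add = complex_pair.linear_add
  and clinear_diff = complex_pair.linear_diff
  and clinear_scale = complex_pair.linear_scale
  and clinear_0 = complex_pair.linear_0

lemma clinear_iff:
  "clinear f \<longleftrightarrow> (\<forall>x y. f (x + y) = f x + f y) \<and> (\<forall>c x. f (c *\<^sub>C x) = c *\<^sub>C f x)"
  unfolding Vector_Spaces.linear_iff using complex_vector.vector_space_axioms by blast

lemma clinear_inv:
  assumes "clinear U" "bij U"
  shows "clinear (inv U)"
  unfolding clinear_iff
proof (intro conjI allI)
  have U: "U (inv U x) = x" "inv U (U x) = x" for x
    using assms(2) by (simp_all add: bij_is_surj surj_f_inv_f bij_is_inj)
  show "inv U (x + y) = inv U x + inv U y" for x y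
    using U(2)[of "inv U x + inv U y"] by (simp add: clinear_add[OF assms(1)] U(1))
  show "inv U (c *\<^sub>C x) = c *\<^sub>C inv U x" for c x
    using U(2)[of "c *\<^sub>C inv U x"] by (simp add: clinear_scale[OF assms(1)] U(1))
qed

lemma clinear_funpow: "clinear A \<Longrightarrow> clinear (A ^^ n)"
  by (induction n) (simp_all add: clinear_iff)

lemma subspace_null_space: "clinear A \<Longrightarrow> complex_vector.subspace (null_space A)"
  unfolding null_space_def by (rule complex_pair.linear_subspace_kernel)

lemma subspace_range: "clinear A \<Longrightarrow> complex_vector.subspace (range A)"
  by (rule complex_pair.linear_subspace_image) simp_all

definition fin_dim :: "'a::complex_normed_vector set \<Rightarrow> bool" where
  "fin_dim V \<longleftrightarrow> (\<exists>B. finite B \<and> V \<subseteq> complex_vector.span B)"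

lemma fin_dim_subset: "V \<subseteq> W \<Longrightarrow> fin_dim W \<Longrightarrow> fin_dim V"
  unfolding fin_dim_def by blast

lemma fin_dim_span: "finite B \<Longrightarrow> fin_dim (complex_vector.span B)"
  unfolding fin_dim_def by blast

lemma cdim_fin_dim: "fin_dim V \<Longrightarrow> cdim V = enat (complex_vector.dim V)"
  by (simp add: cdim_def fin_dim_def)

lemma cdim_finite_iff: "cdim V < \<infinity> \<longleftrightarrow> fin_dim V"
  by (auto simp: cdim_def fin_dim_def)

lemma cdim_span_independent:
  "finite B \<Longrightarrow> complex_vector.independent B \<Longrightarrow> cdim (complex_vector.span B) = enat (card B)"
  by (simp add: cdim_fin_dim fin_dim_span complex_vector.dim_eq_card_independent)

lemma fin_dim_extend_basis:
  assumes V: "complex_vector.subspace V" "fin_dim V"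
    and S: "S \<subseteq> V" "complex_vector.independent S"
  obtains B where "S \<subseteq> B" "finite B" "complex_vector.independent B" "complex_vector.span B = V"
proof -
  obtain B where B: "S \<subseteq> B" "B \<subseteq> V" "complex_vector.independent B" "V \<subseteq> complex_vector.span B"
    using complex_vector.maximal_independent_subset_extend[OF S] by blast
  have "finite B"
    using V(2) B complex_vector.independent_span_bound unfolding fin_dim_def by (meson order_trans)
  moreover have "complex_vector.span B = V"
    using B V by (simp add: complex_vector.span_minimal subset_antisym)
  ultimately show ?thesis using B that by blast
qed

lemma fin_dim_basis:
  assumes "complex_vector.subspace V" "fin_dim V"
  obtains B where "finite B" "complex_vector.independent B" "complex_vector.span B = V"
    "card B = complex_vector.dim V"
proof -
  obtain B where "finite B" "complex_vector.independent B" "complex_vector.span B = V"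
    using fin_dim_extend_basis[OF assms empty_subsetI complex_vector.independent_empty] .
  moreover from this have "card B = complex_vector.dim V"
    using complex_vector.dim_span_eq_card_independent by metis
  ultimately show ?thesis using that by metis
qed

lemma span_disjoint_parts:
  assumes B: "complex_vector.independent B" and sub: "S \<subseteq> B" "T \<subseteq> B" "S \<inter> T = {}"
    and x: "x \<in> complex_vector.span S" "x \<in> complex_vector.span T"
  shows "x = 0"
proof -
  obtain s u where s: "finite s" "s \<subseteq> S" "x = (\<Sum>v\<in>s. u v *\<^sub>C v)"
    using x(1) unfolding complex_vector.span_explicit by blast
  obtain t w where t: "finite t" "t \<subseteq> T" "x = (\<Sum>v\<in>t. w v *\<^sub>C v)"
    using x(2) unfolding complex_vector.span_explicit by blast
  have disj: "s \<inter> t = {}" using s t sub by blast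
  define c where "c v = (if v \<in> s then u v else - w v)" for v
  have "(\<Sum>v\<in>s \<union> t. c v *\<^sub>C v) = (\<Sum>v\<in>s. c v *\<^sub>C v) + (\<Sum>v\<in>t. c v *\<^sub>C v)"
    using s t disj by (intro sum.union_disjoint) auto
  also have "(\<Sum>v\<in>s. c v *\<^sub>C v) = x" using s by (simp add: c_def)
  also have "(\<Sum>v\<in>t. c v *\<^sub>C v) = (\<Sum>v\<in>t. - (w v *\<^sub>C v))"
    using disj by (intro sum.cong) (auto simp: c_def)
  also have "\<dots> = - x" using t by (simp add: sum_negf)
  finally have "(\<Sum>v\<in>s \<union> t. c v *\<^sub>C v) = 0" by simp
  then have "c v = 0" if "v \<in> s \<union> t" for v
    using complex_vector.independentD[OF B, of "s \<union> t" c v] s t sub that by blast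
  then have "u v = 0" if "v \<in> s" for v
    using that by (metis UnI1 c_def)
  then show ?thesis unfolding s(3) by (intro sum.neutral) simp
qed

text \<open>
  Rank and nullity: \<open>A\<close> induces a bijection of the quotients by \<open>V\<close> and \<open>W\<close>, so its kernel and
  cokernel are those of its restriction \<open>V \<rightarrow> W\<close>, a linear map between spaces of the same finite
  dimension.
\<close>

lemma nullity_eq_defect_if_finite_part:
  fixes A :: "'a::complex_normed_vector \<Rightarrow> 'a"
  assumes A: "clinear A"
    and V: "complex_vector.subspace V" "fin_dim V"
    and W: "complex_vector.subspace W" "fin_dim W"
    and dim: "complex_vector.dim V = complex_vector.dim W"
    and iff: "\<And>x. A x \<in> W \<longleftrightarrow> x \<in> V"
    and sum: "\<And>y. \<exists>w\<in>W. \<exists>x. y = A x + w"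
  shows "nullity A = defect A \<and> nullity A < \<infinity>"
proof -
  let ?span = "complex_vector.span"
  have NV: "null_space A \<subseteq> V"
  proof
    fix x assume "x \<in> null_space A"
    then have "A x \<in> W" using complex_vector.subspace_0[OF W(1)] by (simp add: null_space_def)
    then show "x \<in> V" unfolding iff .
  qed
  obtain B0 where B0: "finite B0" "complex_vector.independent B0" "?span B0 = null_space A"
    using fin_dim_basis[OF subspace_null_space[OF A]] fin_dim_subset[OF NV V(2)] by metis
  have "B0 \<subseteq> V" using B0(3) NV complex_vector.span_superset by blast
  then obtain B where B: "B0 \<subseteq> B" "finite B" "complex_vector.independent B" "?span B = V"
    using fin_dim_extend_basis[OF V _ B0(2)] by blast
  define B1 where "B1 = B - B0"
  have BB: "B = B0 \<union> B1" "B1 \<subseteq> B" "B0 \<inter> B1 = {}" using B by (auto simp: B1_def)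
  have inj: "inj_on A (?span B1)"
  proof (rule inj_onI)
    fix x y assume xy: "x \<in> ?span B1" "y \<in> ?span B1" "A x = A y"
    then have "x - y \<in> ?span B0" using A by (simp add: B0 null_space_def clinear_diff)
    moreover have "x - y \<in> ?span B1" using xy by (simp add: complex_vector.span_diff)
    ultimately have "x - y = 0" using span_disjoint_parts[OF B(3,1) BB(2,3)] by blast
    then show "x = y" by simp
  qed
  have "complex_vector.independent B1"
    using B(3) BB(2) by (rule complex_vector.independent_mono)
  then have indAB: "complex_vector.independent (A ` B1)"
    using inj by (rule complex_pair.linear_independent_injective_image[OF A])
  have "A ` B1 \<subseteq> W"
    using iff B(4) BB(2) complex_vector.span_superset[of B] by (metis image_subset_iff subsetD)
  then obtain C where C: "A ` B1 \<subseteq> C" "finite C" "complex_vector.independent C" "?span C = W"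
    using fin_dim_extend_basis[OF W _ indAB] by blast
  \<comment> \<open>The basis \<open>B1\<close> of a complement of the kernel in \<open>V\<close> is mapped to the independent part \<open>A ` B1\<close> of
    the basis \<open>C\<close> of \<open>W\<close>; the remaining vectors \<open>D\<close> span a complement of the range.\<close>
  define D where "D = C - A ` B1"
  have CD: "C = A ` B1 \<union> D" "D \<subseteq> C" "A ` B1 \<inter> D = {}" using C by (auto simp: D_def)
  have spanAB: "?span (A ` B1) \<subseteq> range A"
    using complex_pair.linear_span_image[OF A] by auto
  have "card (A ` B1) = card B1"
    using inj_on_subset[OF inj complex_vector.span_superset] by (rule card_image)
  moreover have "card C = card B"
    using dim complex_vector.dim_span_eq_card_independent[OF B(3)]
      complex_vector.dim_span_eq_card_independent[OF C(3)] B(4) C(4) by simp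
  moreover have "card C = card (A ` B1) + card D" "card B = card B0 + card B1"
    using B(2) C(2) BB(1,3) CD(1,3) by (metis card_Un_disjoint finite_Un)+
  ultimately have card: "card D = card B0" by simp
  have indD: "complex_vector.independent D" "finite D"
    using C CD complex_vector.independent_mono finite_subset by blast+
  have "codim (range A) = cdim (?span D)"
  proof (rule codim_eq_cdim_complement)
    show "complex_vector.subspace (range A)" by (rule subspace_range[OF A])
    have "y = 0" if y: "y \<in> range A" "y \<in> ?span D" for y
    proof -
      obtain x where x: "y = A x" using y by blast
      have "y \<in> W" using y(2) C(4) CD(2) complex_vector.span_mono by blast
      then have "x \<in> ?span (B0 \<union> B1)" using x iff B(4) BB(1) by metis
      then obtain b0 b1 where b: "x = b0 + b1" "b0 \<in> ?span B0" "b1 \<in> ?span B1"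
        unfolding complex_vector.span_Un by blast
      then have "y = A b1" using x A B0(3) by (simp add: null_space_def clinear_add)
      then have "y \<in> ?span (A ` B1)" using b(3) complex_pair.linear_span_image[OF A] by blast
      then show ?thesis using span_disjoint_parts[OF C(3,1) CD(2,3)] y by blast
    qed
    then show "range A \<inter> ?span D = {0}"
      using complex_vector.span_zero complex_vector.subspace_0[OF subspace_range[OF A]] by blast
    fix y
    obtain w x where wx: "w \<in> W" "y = A x + w" using sum by blast
    then obtain c d where "w = c + d" "c \<in> ?span (A ` B1)" "d \<in> ?span D"
      using C(4) CD(1) complex_vector.span_Un by blast
    then obtain z where "w = A z + d" "d \<in> ?span D" using spanAB by blast
    then have "y = A (x + z) + d" "d \<in> ?span D" using wx A by (simp_all add: clinear_add)
    then show "\<exists>m\<in>range A. \<exists>w\<in>?span D. y = m + w" by blast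
  qed simp
  also have "\<dots> = cdim (?span B0)"
    using card indD B0(1,2) by (simp add: cdim_span_independent)
  finally show ?thesis
    using cdim_span_independent[OF B0(1,2)] unfolding nullity_def defect_def B0(3) by simp
qed

section \<open>Differences of bijections and finite-rank maps\<close>

definition finite_rank :: "('a::complex_normed_vector \<Rightarrow> 'a) \<Rightarrow> bool" where
  "finite_rank F \<longleftrightarrow> clinear F \<and> fin_dim (range F)"

text \<open>
  The notion is purely algebraic, since nullity and defect depend on the linear structure only; so
  it passes to powers of an operator by algebra alone.
\<close>

definition bij_minus_finite_rank :: "('a::complex_normed_vector \<Rightarrow> 'a) \<Rightarrow> bool" where
  "bij_minus_finite_rank A \<longleftrightarrow>
     (\<exists>U F. clinear U \<and> bij U \<and> finite_rank F \<and> (\<forall>x. A x = U x - F x))"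

text \<open>
  For \<open>A = U - F\<close> and \<open>W = R(F)\<close> the vectors \<open>A x\<close> and \<open>U x\<close> agree modulo \<open>W\<close>, so outside the finite
  part \<open>U\<^sup>-\<^sup>1(W) \<rightarrow> W\<close> the map \<open>A\<close> behaves like the bijection \<open>U\<close>.
\<close>

lemma bij_minus_finite_rank_imp:
  assumes "bij_minus_finite_rank A"
  shows "nullity A = defect A \<and> nullity A < \<infinity>"
proof -
  obtain U F where U: "clinear U" "bij U" and F: "finite_rank F" and A: "\<And>x. A x = U x - F x"
    using assms unfolding bij_minus_finite_rank_def by blast
  have linF: "clinear F" using F by (simp add: finite_rank_def)
  define W where "W = range F"
  have W: "complex_vector.subspace W" "fin_dim W"
    using F subspace_range by (auto simp: W_def finite_rank_def)
  define I where "I = inv U"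
  have I: "clinear I"
    unfolding I_def using U by (rule clinear_inv)
  have injI: "inj I" unfolding I_def using U by (simp add: bij_imp_bij_inv bij_is_inj)
  obtain B where B: "finite B" "complex_vector.independent B" "complex_vector.span B = W"
    "card B = complex_vector.dim W"
    using fin_dim_basis[OF W] by blast
  have IW: "I ` W = complex_vector.span (I ` B)"
    using complex_pair.linear_span_image[OF I] B by simp
  have "complex_vector.independent (I ` B)"
    using B(2) inj_on_subset[OF injI subset_UNIV] by (rule complex_pair.linear_independent_injective_image[OF I])
  then have "complex_vector.dim (I ` W) = card (I ` B)"
    unfolding IW by (rule complex_vector.dim_span_eq_card_independent)
  then have dim: "complex_vector.dim (I ` W) = complex_vector.dim W"
    using B(4) card_image[OF inj_on_subset[OF injI subset_UNIV, of B]] by simp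
  have AW: "A x \<in> W \<longleftrightarrow> U x \<in> W" for x
    using W(1) complex_vector.subspace_diff[OF W(1), of "U x" "F x"]
      complex_vector.subspace_add[OF W(1), of "A x" "F x"] by (auto simp: A W_def)
  have UW: "U x \<in> W \<longleftrightarrow> x \<in> I ` W" for x
  proof -
    have "U (I y) = y" "I (U y) = y" for y
      using U(2) by (simp_all add: I_def bij_is_surj surj_f_inv_f bij_is_inj)
    then show ?thesis by (metis image_iff)
  qed
  show ?thesis
  proof (rule nullity_eq_defect_if_finite_part)
    show "clinear A" using U(1) linF by (simp add: clinear_iff A complex_vector.scale_right_diff_distrib)
    show "complex_vector.subspace (I ` W)" using I W(1) by (rule complex_pair.linear_subspace_image)
    show "fin_dim (I ` W)" unfolding IW using B(1) by (simp add: fin_dim_span)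
    show "\<exists>w\<in>W. \<exists>x. y = A x + w" for y
    proof -
      obtain x where "y = U x" using surjD[OF bij_is_surj[OF U(2)]] by blast
      then have "y = A x + F x" by (simp add: A)
      then show ?thesis by (auto simp: W_def)
    qed
    show "A x \<in> W \<longleftrightarrow> x \<in> I ` W" for x using AW UW by blast
  qed (rule W dim)+
qed

lemma fin_dim_image:
  assumes "clinear A" "fin_dim V"
  shows "fin_dim (A ` V)"
proof -
  obtain B where B: "finite B" "V \<subseteq> complex_vector.span B"
    using assms(2) unfolding fin_dim_def by blast
  have "A ` V \<subseteq> complex_vector.span (A ` B)"
    using B(2) by (rule complex_pair.linear_spans_image[OF assms(1)])
  then show ?thesis using B(1) unfolding fin_dim_def by blast
qed

lemma fin_dim_sum:
  assumes "fin_dim V" "fin_dim W"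
  shows "fin_dim {x + y |x y. x \<in> V \<and> y \<in> W}"
proof -
  obtain B C where "finite B" "V \<subseteq> complex_vector.span B" "finite C" "W \<subseteq> complex_vector.span C"
    using assms unfolding fin_dim_def by blast
  then have "finite (B \<union> C)"
    "{x + y |x y. x \<in> V \<and> y \<in> W} \<subseteq> complex_vector.span (B \<union> C)"
    unfolding complex_vector.span_Un by blast+
  then show ?thesis unfolding fin_dim_def by blast
qed

lemma bij_minus_finite_rank_funpow:
  assumes "bij_minus_finite_rank A"
  shows "bij_minus_finite_rank (A ^^ n)"
proof -
  obtain U F where U: "clinear U" "bij U" and F: "finite_rank F" and A: "\<And>x. A x = U x - F x"
    using assms unfolding bij_minus_finite_rank_def by blast
  have linA: "clinear A"
    using U(1) F by (simp add: finite_rank_def clinear_iff A complex_vector.scale_right_diff_distrib)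
  have fr: "finite_rank (\<lambda>x. (U ^^ n) x - (A ^^ n) x)" for n
  proof (induction n)
    case 0
    have "fin_dim {0::'a}" using fin_dim_span[of "{}"] by simp
    then show ?case by (simp add: finite_rank_def clinear_iff)
  next
    case (Suc n)
    define G where "G x = (U ^^ n) x - (A ^^ n) x" for x
    have G: "fin_dim (range G)" using Suc by (simp add: G_def finite_rank_def)
    have eq: "(U ^^ Suc n) x - (A ^^ Suc n) x = U (G x) + F ((A ^^ n) x)" for x
      using U(1) by (simp add: A G_def clinear_diff)
    have "clinear (\<lambda>x. (U ^^ Suc n) x - (A ^^ Suc n) x)"
      using clinear_funpow[OF U(1), of "Suc n"] clinear_funpow[OF linA, of "Suc n"]
      unfolding clinear_iff by (simp add: complex_vector.scale_right_diff_distrib)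
    moreover have "fin_dim (range (\<lambda>x. (U ^^ Suc n) x - (A ^^ Suc n) x))"
      using fin_dim_sum[OF fin_dim_image[OF U(1) G], of "range F"] F
      by (rule_tac fin_dim_subset) (auto simp: eq finite_rank_def simp del: funpow.simps)
    ultimately show ?case unfolding finite_rank_def by blast
  qed
  have "clinear (U ^^ n)" "bij (U ^^ n)"
    using U clinear_funpow by (auto intro: bij_fn)
  then show ?thesis unfolding bij_minus_finite_rank_def using fr[of n]
    by (intro exI[of _ "U ^^ n"] exI[of _ "\<lambda>x. (U ^^ n) x - (A ^^ n) x"]) simp
qed

section \<open>Bounded functionals\<close>

text \<open>
  The proof of the Hahn-Banach theorem below works with everywhere defined sublinear functions and
  not with functionals on subspaces: a sublinear function that is minimal in the pointwise order is
  linear. Scaling by \<open>t > 0\<close> is required as an inequality only; the equation follows by scaling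
  with \<open>1/t\<close>.
\<close>

definition sublinear :: "('a::real_normed_vector \<Rightarrow> real) \<Rightarrow> bool" where
  "sublinear q \<longleftrightarrow> q 0 = 0 \<and> (\<forall>x y. q (x + y) \<le> q x + q y) \<and> (\<forall>t>0. \<forall>x. q (t *\<^sub>R x) \<le> t * q x)"

lemma sublinear_minus: "sublinear q \<Longrightarrow> - q (- x) \<le> q x"
  unfolding sublinear_def by (metis add.right_inverse neg_le_0_iff_le le_add_same_cancel1 minus_le_iff add.commute
      add_le_cancel_left add.right_neutral)

lemma sublinear_scale:
  assumes q: "sublinear q" and t: "t > 0"
  shows "q (t *\<^sub>R x) = t * q x"
proof (rule antisym)
  have "q ((1/t) *\<^sub>R (t *\<^sub>R x)) \<le> (1/t) * q (t *\<^sub>R x)"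
    using q t unfolding sublinear_def by (metis zero_less_divide_1_iff)
  then show "t * q x \<le> q (t *\<^sub>R x)" using t by (simp add: field_simps)
qed (use q t in \<open>simp add: sublinear_def\<close>)

text \<open>
  The function \<open>x \<mapsto> inf\<^sub>t\<^sub>\<ge>\<^sub>0 (q(x + t y) - t q(y))\<close> is the sublinear function used in both places where
  the argument needs a smaller one: to show that a minimal function is odd, and to force a
  functional to attain the norm at a given vector.
\<close>

lemma sublinear_decrease:
  assumes q: "sublinear q"
  obtains r where "sublinear r" "r \<le> q" "r (- y) \<le> - q y"
proof -
  have add: "q (u + v) \<le> q u + q v" for u v using q by (simp add: sublinear_def)
  have q0: "q 0 = 0" using q by (simp add: sublinear_def)
  define g where "g x t = q (x + t *\<^sub>R y) - t * q y" for x t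
  have low: "- q (- x) \<le> g x t" if "t \<ge> 0" for x t
  proof -
    have "q (t *\<^sub>R y) = t * q y"
      using sublinear_scale[OF q, of t y] that q0 by (cases "t = 0") auto
    moreover have "q (t *\<^sub>R y) \<le> q (x + t *\<^sub>R y) + q (- x)"
      using add[of "x + t *\<^sub>R y" "- x"] by simp
    ultimately show ?thesis by (simp add: g_def)
  qed
  have bdd: "bdd_below (g x ` {0..})" for x by (rule bdd_belowI[of _ "- q (- x)"]) (use low in auto)
  define r where "r x = (INF t\<in>{0..}. g x t)" for x
  have le: "r x \<le> g x t" if "t \<ge> 0" for x t
    unfolding r_def using that by (intro cINF_lower bdd) auto
  have ge: "c \<le> r x" if "\<And>t. t \<ge> 0 \<Longrightarrow> c \<le> g x t" for c x
    unfolding r_def using that by (intro cINF_greatest) auto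
  have rq: "r x \<le> q x" for x using le[of 0 x] by (simp add: g_def)
  have "sublinear r" unfolding sublinear_def
  proof (intro conjI allI impI)
    have "0 \<le> r 0" using low[of _ 0] q0 by (intro ge) simp
    then show "r 0 = 0" using rq[of 0] q0 by simp
  next
    fix x z
    have *: "r (x + z) \<le> g x s + g z t" if "s \<ge> 0" "t \<ge> 0" for s t
    proof -
      have "r (x + z) \<le> g (x + z) (s + t)" using that by (intro le) simp
      also have "\<dots> \<le> g x s + g z t"
        using add[of "x + s *\<^sub>R y" "z + t *\<^sub>R y"] by (simp add: g_def algebra_simps)
      finally show ?thesis .
    qed
    have "r (x + z) - g z t \<le> r x" if "t \<ge> 0" for t
      using * that by (intro ge) (simp add: algebra_simps)
    then have "r (x + z) - r x \<le> r z" by (intro ge) (simp add: algebra_simps)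
    then show "r (x + z) \<le> r x + r z" by simp
  next
    fix t :: real and x assume t: "t > 0"
    have "r (t *\<^sub>R x) / t \<le> r x"
    proof (rule ge)
      fix s :: real assume s: "s \<ge> 0"
      have "r (t *\<^sub>R x) \<le> g (t *\<^sub>R x) (t * s)" using s t by (intro le) simp
      also have "\<dots> = t * g x s"
        using sublinear_scale[OF q t, of "x + s *\<^sub>R y"] by (simp add: g_def algebra_simps)
      finally show "r (t *\<^sub>R x) / t \<le> g x s" using t by (simp add: field_simps)
    qed
    then show "r (t *\<^sub>R x) \<le> t * r x" using t by (simp add: field_simps)
  qed
  moreover have "r \<le> q" using rq by (simp add: le_fun_def)
  moreover have "r (- y) \<le> - q y" using le[of 1 "- y"] q0 by (simp add: g_def)
  ultimately show ?thesis using that by blast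
qed

lemma minimal_sublinear:
  assumes p: "sublinear p"
  obtains m where "sublinear m" "m \<le> p" "\<And>r. sublinear r \<Longrightarrow> r \<le> m \<Longrightarrow> r = m"
proof -
  define Q where "Q = {q. sublinear q \<and> q \<le> p}"
  have "\<exists>m\<in>Q. \<forall>a\<in>Q. a \<le> m \<longrightarrow> a = m"
  proof (rule predicate_Zorn)
    show "partial_order_on Q (relation_of (\<lambda>x y. y \<le> x) Q)"
      unfolding partial_order_on_def preorder_on_def refl_on_def trans_def antisym_def relation_of_def
      by (auto intro: order_trans order_antisym)
    fix C assume "C \<in> Chains (relation_of (\<lambda>x y. y \<le> x) Q)"
    then have C: "\<And>a. a \<in> C \<Longrightarrow> a \<in> Q" "\<And>a b. a \<in> C \<Longrightarrow> b \<in> C \<Longrightarrow> a \<le> b \<or> b \<le> a"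
      unfolding Chains_def relation_of_def by blast+
    show "\<exists>u\<in>Q. \<forall>a\<in>C. u \<le> a"
    proof (cases "C = {}")
      case True
      then show ?thesis using p by (intro bexI[of _ p]) (auto simp: Q_def)
    next
      case False
      have Cs: "sublinear q" "q \<le> p" if "q \<in> C" for q using C(1)[OF that] by (auto simp: Q_def)
      have low: "- p (- x) \<le> q x" if "q \<in> C" for q x
        using sublinear_minus[OF Cs(1)[OF that], of x] le_funD[OF Cs(2)[OF that], of "- x"] by simp
      define u where "u x = (INF q\<in>C. q x)" for x
      have le: "u x \<le> q x" if "q \<in> C" for q x
        unfolding u_def using that low by (intro cINF_lower bdd_belowI[of _ "- p (- x)"]) auto
      have ge: "c \<le> u x" if "\<And>q. q \<in> C \<Longrightarrow> c \<le> q x" for c x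
        unfolding u_def using that False by (intro cINF_greatest) auto
      have "sublinear u" unfolding sublinear_def
      proof (intro conjI allI impI)
        have "q 0 = 0" if "q \<in> C" for q using Cs(1)[OF that] by (simp add: sublinear_def)
        then have "u 0 = (INF q\<in>C. 0)" unfolding u_def by (intro INF_cong) auto
        then show "u 0 = 0" using False by simp
      next
        fix x z
        have *: "u (x + z) \<le> q1 x + q2 z" if "q1 \<in> C" "q2 \<in> C" for q1 q2
        proof -
          from C(2)[OF that] that obtain q where q: "q \<in> C" "q \<le> q1" "q \<le> q2" by blast
          have "u (x + z) \<le> q (x + z)" by (rule le[OF q(1)])
          also have "\<dots> \<le> q x + q z" using Cs(1)[OF q(1)] by (simp add: sublinear_def)
          also have "\<dots> \<le> q1 x + q2 z" using q(2,3) by (intro add_mono) (auto simp: le_fun_def)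
          finally show ?thesis .
        qed
        have "u (x + z) - q z \<le> u x" if "q \<in> C" for q
          using * that by (intro ge) (simp add: algebra_simps)
        then have "u (x + z) - u x \<le> u z" by (intro ge) (simp add: algebra_simps)
        then show "u (x + z) \<le> u x + u z" by simp
      next
        fix t :: real and x assume t: "t > 0"
        have "u (t *\<^sub>R x) / t \<le> u x"
        proof (rule ge)
          fix q assume q: "q \<in> C"
          have "u (t *\<^sub>R x) \<le> t * q x" using le[OF q, of "t *\<^sub>R x"] sublinear_scale[OF Cs(1)[OF q] t] by simp
          then show "u (t *\<^sub>R x) / t \<le> q x" using t by (simp add: field_simps)
        qed
        then show "u (t *\<^sub>R x) \<le> t * u x" using t by (simp add: field_simps)
      qed
      moreover have "u \<le> q" if "q \<in> C" for q using le[OF that] by (simp add: le_fun_def)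
      moreover from this have "u \<le> p" using False Cs(2) order_trans by blast
      ultimately show ?thesis by (auto simp: Q_def)
    qed
  qed
  then obtain m where m: "m \<in> Q" "\<And>a. a \<in> Q \<Longrightarrow> a \<le> m \<Longrightarrow> a = m" by blast
  show ?thesis
  proof (rule that)
    show "sublinear m" "m \<le> p" using m(1) by (auto simp: Q_def)
    fix r assume "sublinear r" "r \<le> m"
    moreover from this have "r \<le> p" using \<open>m \<le> p\<close> by (rule_tac order_trans)
    ultimately show "r = m" using m(2) by (simp add: Q_def)
  qed
qed

text \<open>
  Decreasing \<open>m\<close> at \<open>y\<close> changes nothing, so \<open>m (- y) \<le> - m y\<close>; a subadditive function that is odd
  is additive.
\<close>

lemma minimal_sublinear_linear:
  assumes m: "sublinear m" and minimal: "\<And>r. sublinear r \<Longrightarrow> r \<le> m \<Longrightarrow> r = m"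
  shows "linear m"
proof -
  have minus: "m (- y) = - m y" for y
  proof -
    obtain r where "sublinear r" "r \<le> m" "r (- y) \<le> - m y"
      using sublinear_decrease[OF m, of y] by metis
    then have "m (- y) \<le> - m y" using minimal by blast
    then show ?thesis using sublinear_minus[OF m, of y] by simp
  qed
  have le: "m (x + y) \<le> m x + m y" for x y using m by (simp add: sublinear_def)
  show ?thesis
  proof (rule linearI)
    show "m (x + y) = m x + m y" for x y
      using le[of x y] le[of "x + y" "- y"] minus[of y] by simp
    show "m (c *\<^sub>R x) = c *\<^sub>R m x" for c x
    proof (cases c "0::real" rule: linorder_cases)
      case less
      then have "m ((- c) *\<^sub>R x) = (- c) * m x" by (intro sublinear_scale m) simp
      then show ?thesis using minus[of "c *\<^sub>R x"] by simp
    next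
      case equal
      then show ?thesis using m by (simp add: sublinear_def)
    next
      case greater
      then show ?thesis using sublinear_scale[OF m] by simp
    qed
  qed
qed

text \<open>
  The norm is first decreased to a sublinear \<open>p\<close> with \<open>p(- x0) \<le> - norm x0\<close>; any linear minorant of
  \<open>p\<close> then takes the value \<open>norm x0\<close> at \<open>x0\<close>.
\<close>

lemma norming_real_functional:
  fixes x0 :: "'a::real_normed_vector"
  obtains f :: "'a \<Rightarrow> real" where "linear f" "\<And>x. \<bar>f x\<bar> \<le> norm x" "f x0 = norm x0"
proof -
  have "sublinear (norm :: 'a \<Rightarrow> real)" by (auto simp: sublinear_def norm_triangle_ineq)
  then obtain p where p: "sublinear p" "p \<le> norm" "p (- x0) \<le> - norm x0"
    using sublinear_decrease by blast
  obtain m where m: "sublinear m" "m \<le> p" "\<And>r. sublinear r \<Longrightarrow> r \<le> m \<Longrightarrow> r = m"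
    using minimal_sublinear[OF p(1)] by blast
  have lin: "linear m" using m by (intro minimal_sublinear_linear) auto
  have le: "m x \<le> norm x" for x using m(2) p(2) by (metis le_funD order_trans)
  have minus: "m (- x) = - m x" for x using lin by (rule linear_neg)
  show ?thesis
  proof (rule that[OF lin])
    show "\<bar>m x\<bar> \<le> norm x" for x using le[of x] le[of "- x"] minus[of x] by simp
    have "m (- x0) \<le> - norm x0" using le_funD[OF m(2), of "- x0"] p(3) by simp
    then show "m x0 = norm x0" using minus[of x0] le[of x0] by simp
  qed
qed

definition cfunctional :: "('a::complex_normed_vector \<Rightarrow> complex) \<Rightarrow> bool" where
  "cfunctional f \<longleftrightarrow> bounded_linear f \<and> (\<forall>c x. f (c *\<^sub>C x) = c * f x)"

lemma cfunctional_bounded_linear: "cfunctional f \<Longrightarrow> bounded_linear f"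
  by (simp add: cfunctional_def)

lemma cfunctional_add: "cfunctional f \<Longrightarrow> f (x + y) = f x + f y"
  by (simp add: cfunctional_def linear_simps)

lemma cfunctional_diff: "cfunctional f \<Longrightarrow> f (x - y) = f x - f y"
  by (simp add: cfunctional_def linear_simps)

lemma cfunctional_scaleC: "cfunctional f \<Longrightarrow> f (c *\<^sub>C x) = c * f x"
  by (simp add: cfunctional_def)

lemma cfunctional_sum: "cfunctional f \<Longrightarrow> f (\<Sum>b\<in>B. g b) = (\<Sum>b\<in>B. f (g b))"
  by (simp add: cfunctional_def bounded_linear.linear linear_sum)

lemma cfunctional_nonzero:
  fixes x0 :: "'a::complex_normed_vector"
  assumes "x0 \<noteq> 0"
  obtains f where "cfunctional f" "f x0 = 1"
proof -
  obtain f :: "'a \<Rightarrow> real" where f: "linear f" "\<And>x. \<bar>f x\<bar> \<le> norm x" "f x0 = norm x0"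
    using norming_real_functional by blast
  \<comment> \<open>The complex-linear functional with real part \<open>f\<close>.\<close>
  define g where "g x = Complex (f x) (- f (\<i> *\<^sub>C x))" for x
  have add: "f (x + y) = f x + f y" for x y using f(1) by (rule linear_add)
  have scale: "f (r *\<^sub>R x) = r * f x" for r x using linear_scale[OF f(1)] by simp
  have gC: "g (c *\<^sub>C x) = c * g x" for c x
  proof -
    have c: "f (c *\<^sub>C x) = Re c * f x + Im c * f (\<i> *\<^sub>C x)" for c x
    proof -
      have "c *\<^sub>C x = Re c *\<^sub>R x + Im c *\<^sub>R (\<i> *\<^sub>C x)"
        by (simp add: scaleR_scaleC scaleC_scaleC complex_eq mult.commute flip: scaleC_add_left)
      then show ?thesis by (simp only: add scale)
    qed
    show ?thesis
      using c[of c x] c[of "\<i> * c" x]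
      by (simp add: g_def complex_eq_iff scaleC_scaleC)
  qed
  have gb: "bounded_linear g"
  proof (rule bounded_linear_intro[where K = 2])
    show "g (x + y) = g x + g y" for x y by (simp add: g_def add scaleC_add_right complex_eq_iff)
    show "g (r *\<^sub>R x) = r *\<^sub>R g x" for r x
      using gC[of "complex_of_real r" x] by (simp add: scaleR_scaleC scaleR_conv_of_real)
    show "norm (g x) \<le> norm x * 2" for x
      using cmod_le[of "g x"] f(2)[of x] f(2)[of "\<i> *\<^sub>C x"] by (simp add: g_def norm_scaleC)
  qed
  have "Re (g x0) \<noteq> 0" using f(3) assms by (simp add: g_def)
  then have nz: "g x0 \<noteq> 0" by force
  show ?thesis
  proof (rule that)
    show "cfunctional (\<lambda>x. g x / g x0)"
      using gb gC by (simp add: cfunctional_def bounded_linear_divide bounded_linear_compose[OF bounded_linear_divide])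
    show "g x0 / g x0 = 1" using nz by simp
  qed
qed

text \<open>
  Induction on the set: for a new vector \<open>a\<close>, a functional that is \<open>1\<close> on the component of \<open>a\<close>
  outside the span of the old vectors yields \<open>g\<close>, which vanishes on the old vectors and is \<open>1\<close> at
  \<open>a\<close>; the old functionals are then corrected by multiples of \<open>g\<close> so that they vanish at \<open>a\<close>.
\<close>

lemma dual_functionals:
  fixes B :: "'a::complex_normed_vector set"
  assumes "finite B" "complex_vector.independent B"
  obtains \<phi> where "\<And>b. b \<in> B \<Longrightarrow> cfunctional (\<phi> b)"
    "\<And>b c. b \<in> B \<Longrightarrow> c \<in> B \<Longrightarrow> \<phi> b c = (if b = c then 1 else 0)"
proof -
  have "\<exists>\<phi>. (\<forall>b\<in>B. cfunctional (\<phi> b)) \<and> (\<forall>b\<in>B. \<forall>c\<in>B. \<phi> b c = (if b = c then 1 else 0))"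
    using assms
  proof (induction B rule: finite_induct)
    case (insert a B)
    then have ind: "complex_vector.independent B" "a \<notin> complex_vector.span B"
      by (auto simp: complex_vector.independent_insert)
    then obtain \<phi> where \<phi>: "\<And>b. b \<in> B \<Longrightarrow> cfunctional (\<phi> b)"
      "\<And>b c. b \<in> B \<Longrightarrow> c \<in> B \<Longrightarrow> \<phi> b c = (if b = c then 1 else 0)"
      using insert.IH by blast
    define rest where "rest x = x - (\<Sum>b\<in>B. \<phi> b x *\<^sub>C b)" for x
    have "rest a \<noteq> 0"
    proof
      assume "rest a = 0"
      then have "a = (\<Sum>b\<in>B. \<phi> b a *\<^sub>C b)" by (simp add: rest_def)
      also have "\<dots> \<in> complex_vector.span B"
        by (intro complex_vector.span_sum complex_vector.span_scale complex_vector.span_base)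
      finally show False using ind by simp
    qed
    then obtain f where f: "cfunctional f" "f (rest a) = 1" using cfunctional_nonzero by blast
    define g where "g x = f (rest x)" for x
    have g_eq: "g x = f x - (\<Sum>b\<in>B. \<phi> b x * f b)" for x
      by (simp add: g_def rest_def cfunctional_diff[OF f(1)] cfunctional_sum[OF f(1)]
          cfunctional_scaleC[OF f(1)])
    have g: "cfunctional g" unfolding cfunctional_def
    proof
      show "bounded_linear g" unfolding g_eq
        by (intro bounded_linear_sub bounded_linear_sum bounded_linear_mult_const
            cfunctional_bounded_linear f \<phi>)
      show "\<forall>c x. g (c *\<^sub>C x) = c * g x"
        by (simp add: g_eq cfunctional_scaleC[OF f(1)] cfunctional_scaleC[OF \<phi>(1)] sum_distrib_left
            algebra_simps)
    qed
    have gB: "g c = 0" if "c \<in> B" for c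
    proof -
      have "(\<Sum>b\<in>B. \<phi> b c * f b) = (\<Sum>b\<in>B. if b = c then f b else 0)"
        using \<phi>(2) that by (intro sum.cong) auto
      then show ?thesis using insert.hyps(1) that by (simp add: g_eq)
    qed
    have ga: "g a = 1" using f(2) by (simp add: g_def)
    define \<psi> where "\<psi> b = (if b = a then g else (\<lambda>x. \<phi> b x - \<phi> b a * g x))" for b
    have "cfunctional (\<psi> b)" if "b \<in> insert a B" for b
    proof (cases "b = a")
      case False
      then have "b \<in> B" using that by simp
      have "bounded_linear (\<lambda>x. \<phi> b x - \<phi> b a * g x)"
        by (intro bounded_linear_sub bounded_linear_const_mult cfunctional_bounded_linear g \<phi> \<open>b \<in> B\<close>)
      then show ?thesis using False
        by (simp add: \<psi>_def cfunctional_def cfunctional_scaleC[OF g] cfunctional_scaleC[OF \<phi>(1)[OF \<open>b \<in> B\<close>]]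
            algebra_simps)
    qed (simp add: \<psi>_def g)
    moreover have "\<psi> b c = (if b = c then 1 else 0)" if "b \<in> insert a B" "c \<in> insert a B" for b c
      using that \<phi>(2)[of b c] gB ga insert.hyps(2) by (auto simp: \<psi>_def)
    ultimately show ?case by blast
  qed simp
  then show ?thesis using that by blast
qed

section \<open>The open mapping theorem for closed subspaces\<close>

lemma Baire_closed_cover:
  fixes B :: "'a::banach set" and S :: "nat \<Rightarrow> 'a set"
  assumes B: "closed B" "B \<noteq> {}" and cover: "B \<subseteq> (\<Union>n. S n)" and S: "\<And>n. closed (S n)"
  obtains n y r where "y \<in> B" "r > 0" "B \<inter> ball y r \<subseteq> S n"
proof -
  interpret sub: Submetric UNIV dist B by unfold_locales auto
  have complete: "sub.sub.mcomplete"
    using B(1) complete_UNIV by (intro sub.closedin_mcomplete_imp_mcomplete) auto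
  have top: "sub.sub.mtopology = top_of_set B"
    using sub.mtopology_submetric by simp
  have "sub.sub.mtopology interior_of \<Union>(range (\<lambda>n. B \<inter> S n)) \<noteq> {}"
  proof -
    have "\<Union>(range (\<lambda>n. B \<inter> S n)) = B" using cover by auto
    then show ?thesis using B(2) interior_of_topspace[of "top_of_set B"] by (simp add: top)
  qed
  then obtain T where T: "T \<in> range (\<lambda>n. B \<inter> S n)"
    "\<not> (closedin sub.sub.mtopology T \<and> sub.sub.mtopology interior_of T = {})"
    using sub.sub.metric_Baire_category_alt[OF complete, of "range (\<lambda>n. B \<inter> S n)"] by fastforce
  then obtain n where n: "T = B \<inter> S n" by blast
  have "closedin (top_of_set B) T" using S n by (simp add: closedin_closed_Int)
  then obtain y where "y \<in> top_of_set B interior_of T" using T(2) top by auto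
  then obtain U where U: "openin (top_of_set B) U" "y \<in> U" "U \<subseteq> T"
    by (auto simp: interior_of_def)
  then have "y \<in> B" "\<exists>r>0. ball y r \<inter> B \<subseteq> U"
    unfolding openin_contains_ball by blast+
  then obtain r where r: "y \<in> B" "r > 0" "ball y r \<inter> B \<subseteq> U" by blast
  show ?thesis using that[of y r n] r U n by blast
qed

text \<open>
  The version for subspaces is needed because it is applied to the restriction of an operator to
  the range of one of its powers and to the intersection of these ranges.
\<close>

theorem open_mapping_closed_subspaces:
  fixes T :: "'a::banach \<Rightarrow> 'b::banach"
  assumes T: "bounded_linear T" and A: "subspace A" "closed A" and B: "closed B" and AB: "T ` A = B"
  obtains C where "C > 0" "\<And>y. y \<in> B \<Longrightarrow> \<exists>x\<in>A. T x = y \<and> norm x \<le> C * norm y"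
proof -
  interpret T: bounded_linear T by fact
  have subB: "subspace B" using linear_subspace_image[OF T.linear A(1)] AB by simp
  define S where "S n = closure (T ` (A \<inter> cball 0 (real n)))" for n :: nat
  have cover: "B \<subseteq> (\<Union>n. S n)"
  proof
    fix y assume "y \<in> B"
    then obtain x where x: "x \<in> A" "T x = y" using AB by blast
    obtain n :: nat where "norm x \<le> real n" using real_arch_simple by blast
    then have "y \<in> T ` (A \<inter> cball 0 (real n))" using x by auto
    then have "y \<in> S n" unfolding S_def by (rule subsetD[OF closure_subset])
    then show "y \<in> (\<Union>n. S n)" by blast
  qed
  have "B \<noteq> {}" using subspace_0[OF subB] by blast
  then obtain n y0 r where y0: "y0 \<in> B" "r > 0" "B \<inter> ball y0 r \<subseteq> S n"
    using Baire_closed_cover[OF B _ cover] by (metis S_def closed_closure)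
  \<comment> \<open>Differences of points near \<open>y0\<close> cover a ball around \<open>0\<close>, up to an arbitrarily small error.\<close>
  have approx: "\<exists>x\<in>A. norm x \<le> 2 * real n \<and> norm (y - T x) < e"
    if y: "y \<in> B" "norm y < r" "e > 0" for y e
  proof -
    have "y0 \<in> S n" "y0 + y \<in> S n"
      using y0 y subspace_add[OF subB] by (auto simp: dist_norm subset_iff)
    then have "\<exists>p\<in>T ` (A \<inter> cball 0 (real n)). dist p (y0 + y) < e / 2"
      "\<exists>p\<in>T ` (A \<inter> cball 0 (real n)). dist p y0 < e / 2"
      unfolding S_def closure_approachable using half_gt_zero[OF y(3)] by blast+
    then obtain u v where uv: "u \<in> A" "norm u \<le> n" "dist (T u) (y0 + y) < e / 2"
      "v \<in> A" "norm v \<le> n" "dist (T v) y0 < e / 2"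
      unfolding bex_simps(7) by auto
    have "y - T (u - v) = (T v - y0) - (T u - (y0 + y))" by (simp add: T.diff)
    then have "norm (y - T (u - v)) \<le> norm (T v - y0) + norm (T u - (y0 + y))"
      by (metis norm_triangle_ineq4)
    also have "\<dots> < e" using uv by (simp add: dist_norm)
    finally have "norm (y - T (u - v)) < e" .
    moreover have "norm (u - v) \<le> 2 * real n" using norm_triangle_ineq4[of u v] uv by simp
    ultimately show ?thesis using subspace_diff[OF A(1) uv(1,4)] by blast
  qed
  define K where "K = 4 * real n / r"
  have "\<exists>x\<in>A. norm x \<le> K * norm y \<and> norm (y - T x) \<le> norm y / 2" if y: "y \<in> B" for y
  proof (cases "y = 0")
    case True
    then show ?thesis using subspace_0[OF A(1)] by (intro bexI[of _ 0]) (auto simp: T.zero)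
  next
    case False
    define t where "t = r / (2 * norm y)"
    have t: "t > 0" "t * norm y = r / 2" using False y0 by (auto simp: t_def)
    have "t *\<^sub>R y \<in> B" "norm (t *\<^sub>R y) < r"
      using subspace_scale[OF subB y] t y0 by auto
    then obtain x where x: "x \<in> A" "norm x \<le> 2 * real n" "norm (t *\<^sub>R y - T x) < r / 4"
      using approx[of "t *\<^sub>R y" "r / 4"] y0 by auto
    have xt: "y - T ((1/t) *\<^sub>R x) = (1/t) *\<^sub>R (t *\<^sub>R y - T x)"
      using t by (simp add: T.scaleR scaleR_diff_right)
    have "norm (y - T ((1/t) *\<^sub>R x)) = (1/t) * norm (t *\<^sub>R y - T x)"
      unfolding xt using t by simp
    also have "\<dots> \<le> (1/t) * (r/4)" using x(3) t by (intro mult_left_mono) auto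
    also have "\<dots> = norm y / 2" using False y0 by (simp add: t_def field_simps)
    finally have 1: "norm (y - T ((1/t) *\<^sub>R x)) \<le> norm y / 2" .
    have "norm ((1/t) *\<^sub>R x) = (1/t) * norm x" using t by simp
    also have "\<dots> \<le> (1/t) * (2 * real n)" using x(2) t by (intro mult_left_mono) auto
    also have "\<dots> = K * norm y" using False y0 by (simp add: t_def K_def field_simps)
    finally show ?thesis using 1 subspace_scale[OF A(1) x(1)] by blast
  qed
  then obtain g where g: "\<And>y. y \<in> B \<Longrightarrow> g y \<in> A" "\<And>y. y \<in> B \<Longrightarrow> norm (g y) \<le> K * norm y"
    "\<And>y. y \<in> B \<Longrightarrow> norm (y - T (g y)) \<le> norm y / 2" by metis
  have K0: "K \<ge> 0" using y0 by (simp add: K_def)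
  have "\<exists>x\<in>A. T x = y \<and> norm x \<le> (2 * K + 1) * norm y" if y: "y \<in> B" for y
  proof -
    \<comment> \<open>Successive approximation: \<open>z k\<close> is the error left after \<open>k\<close> steps, and it is halved each time.\<close>
    define z where "z k = ((\<lambda>y. y - T (g y)) ^^ k) y" for k
    have z_Suc: "z (Suc k) = z k - T (g (z k))" for k by (simp add: z_def)
    have zB: "z k \<in> B" for k
    proof (induction k)
      case (Suc k)
      then have "T (g (z k)) \<in> B" using g(1) AB by blast
      then show ?case using Suc subspace_diff[OF subB] by (simp add: z_Suc)
    qed (simp add: z_def y)
    have zn: "norm (z k) \<le> norm y * (1/2) ^ k" for k
    proof (induction k)
      case (Suc k)
      then show ?case using g(3)[OF zB[of k]] by (simp add: z_Suc)
    qed (simp add: z_def)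
    have gn: "norm (g (z k)) \<le> K * norm y * (1/2) ^ k" for k
      using g(2)[OF zB[of k]] mult_left_mono[OF zn[of k] K0] by (simp add: mult.assoc)
    have sum_half: "(\<lambda>k. K * norm y * (1/2) ^ k) sums (K * norm y * 2)"
      using sums_mult[OF geometric_sums[of "1/2 :: real"], of "K * norm y"] by simp
    have sumn: "summable (\<lambda>k. norm (g (z k)))"
      by (rule summable_comparison_test[OF _ sums_summable[OF sum_half]]) (use gn in auto)
    then have sums: "(\<lambda>k. g (z k)) sums (\<Sum>k. g (z k))" by (simp add: summable_norm_cancel summable_sums)
    define x where "x = (\<Sum>k. g (z k))"
    have part: "(\<lambda>N. \<Sum>k<N. g (z k)) \<longlonglongrightarrow> x" using sums by (simp add: sums_def x_def)
    have "(\<Sum>k<N. g (z k)) \<in> A" for N using g(1) zB by (intro subspace_sum[OF A(1)]) auto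
    then have xA: "x \<in> A" using closed_sequentially[OF A(2) _ part] by blast
    have "T (\<Sum>k<N. g (z k)) = y - z N" for N
      by (induction N) (auto simp: T.zero T.add z_Suc, simp add: z_def)
    then have "(\<lambda>N. y - z N) \<longlonglongrightarrow> T x" using T.tendsto[OF part] by simp
    moreover have "z \<longlonglongrightarrow> 0"
    proof (rule Lim_null_comparison)
      show "(\<lambda>k. norm y * (1/2) ^ k) \<longlonglongrightarrow> 0"
        by (intro tendsto_mult_right_zero LIMSEQ_power_zero) simp
    qed (use zn in simp)
    ultimately have "T x = y" using LIMSEQ_unique tendsto_diff[OF tendsto_const[of y], of z 0] by fastforce
    moreover have "norm x \<le> K * norm y * 2"
      unfolding x_def using summable_norm[OF sumn] suminf_le[OF gn sumn sums_summable[OF sum_half]]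
        sums_unique[OF sum_half] by simp
    then have "norm x \<le> (2 * K + 1) * norm y" by (simp add: algebra_simps) (smt (verit) norm_ge_zero)
    ultimately show ?thesis using xA by blast
  qed
  then show ?thesis using that[of "2 * K + 1"] K0 by simp
qed

section \<open>Operators with equal finite nullity and defect\<close>

lemma bounded_clinear_clinear: "bounded_clinear S \<Longrightarrow> clinear S"
  unfolding bounded_clinear_def clinear_iff by (simp add: bounded_linear.linear linear_add)

lemma bounded_clinear_bounded_linear: "bounded_clinear S \<Longrightarrow> bounded_linear S"
  by (simp add: bounded_clinear_def)

lemma bounded_linear_scaleC: "bounded_linear (\<lambda>x. c *\<^sub>C (x :: 'a::complex_normed_vector))"
  by (rule bounded_linear_intro[where K = "cmod c"])
    (simp_all add: scaleC_add_right scaleR_scaleC scaleC_scaleC norm_scaleC mult.commute)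

lemma bounded_clinear_sub_scaleC:
  assumes "bounded_clinear S"
  shows "bounded_clinear (\<lambda>x. S x - c *\<^sub>C x)"
proof -
  have "bounded_linear (\<lambda>x. S x - c *\<^sub>C x)"
    using bounded_clinear_bounded_linear[OF assms] bounded_linear_scaleC by (rule bounded_linear_sub)
  then show ?thesis
    using assms by (simp add: bounded_clinear_def scaleC_scaleC mult.commute
        complex_vector.scale_right_diff_distrib)
qed

lemma bounded_clinear_funpow:
  assumes "bounded_clinear S"
  shows "bounded_clinear (S ^^ n)"
proof (induction n)
  case (Suc n)
  have "bounded_linear (\<lambda>x. S ((S ^^ n) x))"
    using bounded_clinear_bounded_linear[OF assms] bounded_clinear_bounded_linear[OF Suc]
    by (rule bounded_linear_compose)
  then show ?case using Suc assms by (simp add: bounded_clinear_def o_def)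
qed (simp add: bounded_clinear_def id_def bounded_linear_ident)

lemma bounded_clinear_inv:
  fixes U :: "'a::complex_banach \<Rightarrow> 'a"
  assumes U: "bounded_clinear U" "bij U"
  shows "bounded_clinear (inv U)"
proof -
  have lin: "clinear (inv U)" using bounded_clinear_clinear[OF U(1)] U(2) by (rule clinear_inv)
  have inv: "inv U (U x) = x" for x using U(2) by (simp add: bij_is_inj)
  obtain C where C: "\<And>y. y \<in> UNIV \<Longrightarrow> \<exists>x\<in>UNIV. U x = y \<and> norm x \<le> C * norm y"
    using open_mapping_closed_subspaces[OF bounded_clinear_bounded_linear[OF U(1)] subspace_UNIV closed_UNIV
        closed_UNIV] bij_is_surj[OF U(2)] by metis
  have "bounded_linear (inv U)"
  proof (rule bounded_linear_intro[where K = C])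
    show "inv U (x + y) = inv U x + inv U y" for x y using lin by (rule clinear_add)
    show "inv U (r *\<^sub>R x) = r *\<^sub>R inv U x" for r x
      using clinear_scale[OF lin] by (simp add: scaleR_scaleC)
    show "norm (inv U y) \<le> norm y * C" for y
      using C[of y] inv by (auto simp: mult.commute)
  qed
  then show ?thesis using clinear_scale[OF lin] by (simp add: bounded_clinear_def)
qed

lemma codim_finite_complement:
  assumes M: "complex_vector.subspace M" and fin: "codim M < \<infinity>"
  obtains C where "finite C" "complex_vector.independent C" "codim M = enat (card C)"
    "M \<inter> complex_vector.span C = {0}" "\<And>y. \<exists>m\<in>M. \<exists>c\<in>complex_vector.span C. y = m + c"
proof -
  let ?span = "complex_vector.span"
  obtain B where B: "B \<subseteq> M" "complex_vector.independent B" "M \<subseteq> ?span B"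
    using complex_vector.basis_exists[of M] by metis
  then have sB: "?span B = M" using M by (simp add: complex_vector.span_minimal subset_antisym)
  obtain D where D: "B \<subseteq> D" "complex_vector.independent D" "UNIV \<subseteq> ?span D"
    using complex_vector.maximal_independent_subset_extend[OF subset_UNIV B(2)] by metis
  define C where "C = D - B"
  have DC: "D = B \<union> C" "C \<subseteq> D" "B \<inter> C = {}" using D(1) by (auto simp: C_def)
  have ind: "complex_vector.independent C" using D(2) DC(2) by (rule complex_vector.independent_mono)
  have int: "M \<inter> ?span C = {0}"
    using span_disjoint_parts[OF D(2,1) DC(2,3)] complex_vector.subspace_0[OF M]
      complex_vector.span_zero unfolding sB by blast
  have sum: "\<exists>m\<in>M. \<exists>c\<in>?span C. y = m + c" for y
  proof -
    have "y \<in> ?span (B \<union> C)" using D(3) DC(1) by auto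
    then show ?thesis unfolding complex_vector.span_Un sB by blast
  qed
  have eq: "codim M = cdim (?span C)"
    by (rule codim_eq_cdim_complement[OF M complex_vector.subspace_span int sum])
  then have "fin_dim (?span C)" using fin by (simp flip: cdim_finite_iff)
  then obtain G where G: "finite G" "?span C \<subseteq> ?span G" unfolding fin_dim_def by blast
  have "C \<subseteq> ?span G" using complex_vector.span_superset G(2) by (rule order_trans)
  then have "finite C" using complex_vector.independent_span_bound[OF G(1) ind] by simp
  then show ?thesis using that[OF _ ind _ int sum] eq by (simp add: cdim_span_independent ind)
qed

lemma dim_eq_subspace_eq:
  assumes "complex_vector.subspace V" "complex_vector.subspace W" "V \<subseteq> W" "fin_dim W"
    "complex_vector.dim W \<le> complex_vector.dim V"
  shows "V = W"
proof -
  obtain B where B: "finite B" "complex_vector.independent B" "complex_vector.span B = V"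
    "card B = complex_vector.dim V"
    using fin_dim_basis[OF assms(1) fin_dim_subset[OF assms(3,4)]] .
  have "B \<subseteq> W" using complex_vector.span_superset[of B] B(3) assms(3) by simp
  then obtain C where C: "B \<subseteq> C" "finite C" "complex_vector.independent C" "complex_vector.span C = W"
    using fin_dim_extend_basis[OF assms(2,4) _ B(2)] by metis
  have "card C \<le> card B"
    using assms(5) B(4) complex_vector.dim_span_eq_card_independent[OF C(3)] C(4) by simp
  then have "B = C" using C(1,2) by (simp add: card_seteq)
  then show ?thesis using B(3) C(4) by simp
qed

lemma cdim_eq_subspace_eq:
  assumes "complex_vector.subspace V" "complex_vector.subspace W" "V \<subseteq> W" "cdim W < \<infinity>" "cdim V = cdim W"
  shows "V = W"
proof -
  have "fin_dim W" "fin_dim V" using assms(4,5) by (simp_all flip: cdim_finite_iff)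
  then show ?thesis using dim_eq_subspace_eq[OF assms(1-3)] assms(5) by (simp add: cdim_fin_dim)
qed

text \<open>
  A vector of \<open>M\<close> outside \<open>M'\<close> could be added to a basis of a complement of \<open>M\<close>, and \<open>M'\<close> would have
  larger codimension.
\<close>

lemma codim_eq_subspace_eq:
  assumes M: "complex_vector.subspace M" and M': "complex_vector.subspace M'"
    and sub: "M' \<subseteq> M" and fin: "codim M < \<infinity>" and eq: "codim M' = codim M"
  shows "M' = M"
proof (rule ccontr)
  assume "M' \<noteq> M"
  then obtain x where x: "x \<in> M" "x \<notin> M'" using sub by blast
  obtain C where C: "finite C" "complex_vector.independent C" "codim M = enat (card C)"
    "M \<inter> complex_vector.span C = {0}"
    using codim_finite_complement[OF M fin] by metis
  have "x \<noteq> 0" using x(2) complex_vector.subspace_0[OF M'] by metis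
  then have xC: "x \<notin> C" using C(4) x(1) complex_vector.span_base by blast
  have "independent_mod M' (insert x C)" unfolding independent_mod_def
  proof (intro allI impI)
    fix c assume "(\<Sum>b\<in>insert x C. c b *\<^sub>C b) \<in> M'"
    then have *: "c x *\<^sub>C x + (\<Sum>b\<in>C. c b *\<^sub>C b) \<in> M'" using C(1) xC by simp
    then have "c x *\<^sub>C x + (\<Sum>b\<in>C. c b *\<^sub>C b) - c x *\<^sub>C x \<in> M"
      using sub x(1) by (intro complex_vector.subspace_diff[OF M] complex_vector.subspace_scale[OF M]) auto
    moreover have "(\<Sum>b\<in>C. c b *\<^sub>C b) \<in> complex_vector.span C"
      by (intro complex_vector.span_sum complex_vector.span_scale complex_vector.span_base)
    ultimately have 0: "(\<Sum>b\<in>C. c b *\<^sub>C b) = 0" using C(4) by auto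
    then have "\<forall>b\<in>C. c b = 0" using complex_vector.independentD[OF C(2,1)] by blast
    moreover have "c x = 0"
    proof (rule ccontr)
      assume "c x \<noteq> 0"
      then have "x = inverse (c x) *\<^sub>C (c x *\<^sub>C x)" by (simp add: scaleC_scaleC scaleC_one)
      also have "\<dots> \<in> M'" by (rule complex_vector.subspace_scale[OF M']) (use * 0 in simp)
      finally show False using x(2) by simp
    qed
    ultimately show "\<forall>b\<in>insert x C. c b = 0" by simp
  qed
  then have "enat (card (insert x C)) \<le> codim M'"
    unfolding codim_def using C(1) by (intro Sup_upper) blast
  then show False using eq C(1,3) xC by simp
qed

text \<open>
  Let \<open>F\<close> map a basis \<open>B\<close> of the null space bijectively to a basis \<open>C\<close> of a complement of the range;
  the functionals dual to \<open>B\<close> extend it to a bounded map on the whole space. Then \<open>U = A + F\<close> is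
  bijective. The range of \<open>A\<close> is the image under \<open>U\<close> of the common kernel of the functionals, and
  it is closed because \<open>U\<close> has a bounded inverse.
\<close>

lemma index_zero_structure:
  fixes A :: "'a::complex_banach \<Rightarrow> 'a"
  assumes A: "bounded_clinear A" and ind: "nullity A = defect A" "nullity A < \<infinity>"
  obtains U F where "bounded_clinear U" "bij U" "finite_rank F" "\<And>x. A x = U x - F x" "closed (range A)"
proof -
  let ?span = "complex_vector.span"
  have linA: "clinear A" using A by (rule bounded_clinear_clinear)
  have "fin_dim (null_space A)" using ind(2) unfolding nullity_def cdim_finite_iff .
  then obtain B where B: "finite B" "complex_vector.independent B" "?span B = null_space A"
    using fin_dim_basis[OF subspace_null_space[OF linA]] by metis
  have "codim (range A) < \<infinity>" using ind by (simp add: defect_def)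
  then obtain C where C: "finite C" "complex_vector.independent C" "codim (range A) = enat (card C)"
    "range A \<inter> ?span C = {0}" "\<And>y. \<exists>m\<in>range A. \<exists>c\<in>?span C. y = m + c"
    using codim_finite_complement[OF subspace_range[OF linA]] by metis
  have "nullity A = enat (card B)"
    unfolding nullity_def B(3)[symmetric] by (rule cdim_span_independent[OF B(1,2)])
  then have "card B = card C" using ind(1) C(3) by (simp add: defect_def)
  then obtain h where h: "bij_betw h B C" using finite_same_card_bij[OF B(1) C(1)] by blast
  obtain \<phi> where \<phi>: "\<And>b. b \<in> B \<Longrightarrow> cfunctional (\<phi> b)"
    "\<And>b c. b \<in> B \<Longrightarrow> c \<in> B \<Longrightarrow> \<phi> b c = (if b = c then 1 else 0)"
    using dual_functionals[OF B(1,2)] by metis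
  have \<phi>_sum: "\<phi> b (\<Sum>c\<in>B. u c *\<^sub>C c) = u b" if "b \<in> B" for b u
  proof -
    have "\<phi> b (\<Sum>c\<in>B. u c *\<^sub>C c) = (\<Sum>c\<in>B. if c = b then u c else 0)"
      unfolding cfunctional_sum[OF \<phi>(1)[OF that]]
      using \<phi>(2)[OF that] by (intro sum.cong) (auto simp: cfunctional_scaleC[OF \<phi>(1)[OF that]])
    then show ?thesis using B(1) that by simp
  qed
  have A_sum: "A (\<Sum>b\<in>B. u b *\<^sub>C b) = 0" for u
  proof -
    have "(\<Sum>b\<in>B. u b *\<^sub>C b) \<in> ?span B"
      by (intro complex_vector.span_sum complex_vector.span_scale complex_vector.span_base)
    then show ?thesis by (simp add: B(3) null_space_def)
  qed
  define F where "F x = (\<Sum>b\<in>B. \<phi> b x *\<^sub>C h b)" for x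
  have F_span: "F x \<in> ?span C" for x
    unfolding F_def using bij_betwE[OF h]
    by (intro complex_vector.span_sum complex_vector.span_scale complex_vector.span_base) auto
  have F: "bounded_clinear F" unfolding bounded_clinear_def
  proof (intro conjI allI)
    show "bounded_linear F" unfolding F_def
    proof (rule bounded_linear_sum)
      fix b assume "b \<in> B"
      then have bl: "bounded_linear (\<phi> b)" by (intro cfunctional_bounded_linear \<phi>)
      obtain K where K: "\<And>x. norm (\<phi> b x) \<le> norm x * K" using bounded_linear.bounded[OF bl] by blast
      show "bounded_linear (\<lambda>x. \<phi> b x *\<^sub>C h b)"
      proof (rule bounded_linear_intro[where K = "K * norm (h b)"])
        show "\<phi> b (x + y) *\<^sub>C h b = \<phi> b x *\<^sub>C h b + \<phi> b y *\<^sub>C h b" for x y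
          using linear_add[OF bounded_linear.linear[OF bl]] by (simp add: scaleC_add_left)
        show "\<phi> b (r *\<^sub>R x) *\<^sub>C h b = r *\<^sub>R (\<phi> b x *\<^sub>C h b)" for r x
          using linear_scale[OF bounded_linear.linear[OF bl]]
          by (simp add: scaleR_scaleC scaleC_scaleC scaleR_conv_of_real)
        show "norm (\<phi> b x *\<^sub>C h b) \<le> norm x * (K * norm (h b))" for x
          using mult_right_mono[OF K[of x] norm_ge_zero[of "h b"]] by (simp add: norm_scaleC mult.assoc)
      qed
    qed
    show "F (c *\<^sub>C x) = c *\<^sub>C F x" for c x
      by (simp add: F_def cfunctional_scaleC[OF \<phi>(1)] complex_vector.scale_sum_right scaleC_scaleC)
  qed
  have linF: "clinear F" using F by (rule bounded_clinear_clinear)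
  have "fin_dim (range F)" using F_span C(1) unfolding fin_dim_def by blast
  then have frF: "finite_rank F" using linF by (simp add: finite_rank_def)
  define U where "U x = A x + F x" for x
  have U: "bounded_clinear U"
    using A F by (simp add: bounded_clinear_def U_def[abs_def] bounded_linear_add scaleC_add_right)
  have linU: "clinear U" using U by (rule bounded_clinear_clinear)
  have F0: "\<phi> b x = 0" if "F x = 0" "b \<in> B" for x b
  proof -
    have "F x = (\<Sum>c\<in>C. \<phi> (inv_into B h c) x *\<^sub>C c)"
      unfolding F_def sum.reindex_bij_betw[OF h, symmetric]
      using h by (intro sum.cong) (auto simp: bij_betw_def)
    then have "\<phi> (inv_into B h (h b)) x = 0"
      using complex_vector.independentD[OF C(2,1) order_refl, of "\<lambda>c. \<phi> (inv_into B h c) x" "h b"]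
        that bij_betwE[OF h] by simp
    then show ?thesis using h that(2) by (simp add: bij_betw_def)
  qed
  have "inj U"
  proof (rule injI)
    fix x y assume "U x = U y"
    then have "U (x - y) = 0" by (simp add: clinear_diff[OF linU])
    then have eq: "F (x - y) = A (y - x)" by (simp add: U_def clinear_diff[OF linA] clinear_diff[OF linF] algebra_simps)
    then have "F (x - y) \<in> range A \<inter> ?span C" using F_span[of "x - y"] by (metis IntI rangeI)
    then have F_xy: "F (x - y) = 0" using C(4) by blast
    then have "x - y \<in> null_space A"
      using eq by (simp add: null_space_def clinear_diff[OF linA])
    then obtain u where u: "x - y = (\<Sum>b\<in>B. u b *\<^sub>C b)"
      using B(3) complex_vector.span_finite[OF B(1)] by auto
    then have "u b = 0" if "b \<in> B" for b
      using \<phi>_sum[OF that, of u] F0[OF F_xy that] by simp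
    then have "x - y = 0" unfolding u by (intro sum.neutral) simp
    then show "x = y" by simp
  qed
  moreover have "y \<in> range U" for y
  proof -
    obtain z c where zc: "y = A z + c" "c \<in> ?span C" using C(5)[of y] by auto
    then obtain u where u: "c = (\<Sum>c\<in>C. u c *\<^sub>C c)"
      using complex_vector.span_finite[OF C(1)] by auto
    \<comment> \<open>Changing \<open>z\<close> inside the null space adjusts \<open>F z\<close> without affecting \<open>A z\<close>.\<close>
    define x where "x = z - (\<Sum>b\<in>B. \<phi> b z *\<^sub>C b) + (\<Sum>b\<in>B. u (h b) *\<^sub>C b)"
    have "\<phi> b x = u (h b)" if "b \<in> B" for b
      unfolding x_def using that
      by (simp add: cfunctional_add[OF \<phi>(1)] cfunctional_diff[OF \<phi>(1)] \<phi>_sum)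
    then have "F x = c"
      unfolding F_def u sum.reindex_bij_betw[OF h, symmetric] by simp
    moreover have "A x = A z"
      by (simp add: x_def clinear_add[OF linA] clinear_diff[OF linA] A_sum)
    ultimately have "y = U x" by (simp add: U_def zc)
    then show ?thesis by blast
  qed
  ultimately have bij: "bij U" by (auto simp: bij_def)
  have range: "range A = {y. \<forall>b\<in>B. \<phi> b (inv U y) = 0}"
  proof (intro set_eqI iffI)
    fix y assume "y \<in> range A"
    then obtain z where z: "y = A z" by blast
    define x where "x = z - (\<Sum>b\<in>B. \<phi> b z *\<^sub>C b)"
    have 0: "\<phi> b x = 0" if "b \<in> B" for b
      unfolding x_def using that by (simp add: cfunctional_diff[OF \<phi>(1)] \<phi>_sum)
    then have "U x = y" by (simp add: U_def F_def z x_def clinear_diff[OF linA] A_sum)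
    then have "inv U y = x" using bij by (auto simp: bij_is_inj)
    then show "y \<in> {y. \<forall>b\<in>B. \<phi> b (inv U y) = 0}" using 0 by simp
  next
    fix y assume y: "y \<in> {y. \<forall>b\<in>B. \<phi> b (inv U y) = 0}"
    have "y = U (inv U y)" using bij by (simp add: bij_is_surj surj_f_inv_f)
    also have "\<dots> = A (inv U y)" using y by (simp add: U_def F_def)
    finally show "y \<in> range A" by blast
  qed
  have "closed {y. \<phi> b (inv U y) = 0}" if "b \<in> B" for b
  proof -
    have "continuous_on UNIV (\<lambda>y. \<phi> b (inv U y))"
      using \<phi>(1)[OF that] bounded_clinear_inv[OF U bij]
      by (intro linear_continuous_on bounded_linear_compose[of "\<phi> b" "inv U"])
        (auto simp: cfunctional_def bounded_clinear_def)
    then show ?thesis by (rule closed_Collect_eq[OF _ continuous_on_const])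
  qed
  then have "closed (\<Inter>b\<in>B. {y. \<phi> b (inv U y) = 0})" by blast
  also have "(\<Inter>b\<in>B. {y. \<phi> b (inv U y) = 0}) = range A" unfolding range by blast
  finally show ?thesis using that[OF U bij frF] by (simp add: U_def)
qed

lemma weyl_iff:
  fixes S :: "'a::complex_banach \<Rightarrow> 'a"
  assumes "bounded_clinear S"
  shows "weyl S \<longleftrightarrow> nullity S = defect S \<and> nullity S < \<infinity>"
proof
  assume "weyl S"
  then show "nullity S = defect S \<and> nullity S < \<infinity>"
    by (auto simp: weyl_def fredholm_def fredholm_index_def)
next
  assume *: "nullity S = defect S \<and> nullity S < \<infinity>"
  then have "closed (range S)" using index_zero_structure[OF assms] by blast
  moreover have "defect S < \<infinity>" using * by metis
  ultimately show "weyl S" using * by (simp add: weyl_def fredholm_def fredholm_index_def)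
qed

lemma weyl_imp_bij_minus_finite_rank:
  fixes S :: "'a::complex_banach \<Rightarrow> 'a"
  assumes "bounded_clinear S" "weyl S"
  shows "bij_minus_finite_rank S"
proof -
  obtain U F where "bounded_clinear U" "bij U" "finite_rank F" "\<And>x. S x = U x - F x"
    using index_zero_structure[OF assms(1)] assms weyl_iff by metis
  then show ?thesis unfolding bij_minus_finite_rank_def using bounded_clinear_clinear by blast
qed

lemma bij_minus_finite_rank_imp_weyl:
  fixes S :: "'a::complex_banach \<Rightarrow> 'a"
  shows "bounded_clinear S \<Longrightarrow> bij_minus_finite_rank S \<Longrightarrow> weyl S"
  using bij_minus_finite_rank_imp weyl_iff by blast

lemma weyl_funpow:
  fixes S :: "'a::complex_banach \<Rightarrow> 'a"
  assumes "bounded_clinear S" "weyl S"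
  shows "weyl (S ^^ n)"
  using bounded_clinear_funpow[OF assms(1)]
    bij_minus_finite_rank_funpow[OF weyl_imp_bij_minus_finite_rank[OF assms]]
  by (rule bij_minus_finite_rank_imp_weyl)

text \<open>
  The equation \<open>U x - c x = y\<close> is the fixed point equation of \<open>x \<mapsto> U\<^sup>-\<^sup>1(y + c x)\<close>, a contraction for
  small \<open>c\<close>.
\<close>

lemma bij_perturbation:
  fixes U :: "'a::complex_banach \<Rightarrow> 'a"
  assumes U: "bounded_clinear U" "bij U"
  obtains r where "r > 0" "\<And>c. cmod c < r \<Longrightarrow> bij (\<lambda>x. U x - c *\<^sub>C x)"
proof -
  have I: "bounded_clinear (inv U)" using U by (rule bounded_clinear_inv)
  have linI: "clinear (inv U)" using I by (rule bounded_clinear_clinear)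
  obtain K where K: "K > 0" "\<And>x. norm (inv U x) \<le> norm x * K"
    using bounded_linear.pos_bounded[OF bounded_clinear_bounded_linear[OF I]] by blast
  have "bij (\<lambda>x. U x - c *\<^sub>C x)" if c: "cmod c < 1 / K" for c
  proof -
    have "\<exists>!x. U x - c *\<^sub>C x = y" for y
    proof -
      have "\<exists>!x. inv U (y + c *\<^sub>C x) = x"
      proof (rule banach_fix_type)
        show "0 \<le> cmod c * K" "cmod c * K < 1" using c K(1) by (simp_all add: field_simps)
        show "\<forall>x z. dist (inv U (y + c *\<^sub>C x)) (inv U (y + c *\<^sub>C z)) \<le> cmod c * K * dist x z"
        proof (intro allI)
          fix x z
          have "inv U (y + c *\<^sub>C x) - inv U (y + c *\<^sub>C z) = inv U (c *\<^sub>C (x - z))"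
            unfolding clinear_diff[OF linI, symmetric]
            by (simp add: complex_vector.scale_right_diff_distrib)
          then show "dist (inv U (y + c *\<^sub>C x)) (inv U (y + c *\<^sub>C z)) \<le> cmod c * K * dist x z"
            using K(2)[of "c *\<^sub>C (x - z)"] by (simp add: dist_norm norm_scaleC mult_ac)
        qed
      qed
      moreover have "inv U (y + c *\<^sub>C x) = x \<longleftrightarrow> U x - c *\<^sub>C x = y" for x
      proof -
        have "inv U (y + c *\<^sub>C x) = x \<longleftrightarrow> y + c *\<^sub>C x = U x"
          using U(2) by (metis bij_inv_eq_iff)
        then show ?thesis by (auto simp: algebra_simps)
      qed
      ultimately show ?thesis by simp
    qed
    then show ?thesis by (simp add: bij_iff)
  qed
  then show ?thesis using that[of "1 / K"] K(1) by simp
qed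

text \<open>
  If \<open>S = U - F\<close>, then \<open>S - c = (U - c) - F\<close>, and \<open>U - c\<close> is bijective for small \<open>c\<close>.
\<close>

lemma weyl_perturbation:
  fixes S :: "'a::complex_banach \<Rightarrow> 'a"
  assumes S: "bounded_clinear S" "weyl S"
  obtains r where "r > 0" "\<And>c. cmod c < r \<Longrightarrow> weyl (\<lambda>x. S x - c *\<^sub>C x)"
proof -
  obtain U F where U: "bounded_clinear U" "bij U" and F: "finite_rank F" "\<And>x. S x = U x - F x"
    using index_zero_structure[OF S(1)] S weyl_iff by metis
  obtain r where r: "r > 0" "\<And>c. cmod c < r \<Longrightarrow> bij (\<lambda>x. U x - c *\<^sub>C x)"
    using bij_perturbation[OF U] by blast
  have "weyl (\<lambda>x. S x - c *\<^sub>C x)" if "cmod c < r" for c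
  proof (rule bij_minus_finite_rank_imp_weyl)
    show "bounded_clinear (\<lambda>x. S x - c *\<^sub>C x)" using S(1) by (rule bounded_clinear_sub_scaleC)
    show "bij_minus_finite_rank (\<lambda>x. S x - c *\<^sub>C x)"
      unfolding bij_minus_finite_rank_def
      using bounded_clinear_clinear[OF bounded_clinear_sub_scaleC[OF U(1)]] r(2)[OF that] F
      by (intro exI[of _ "\<lambda>x. U x - c *\<^sub>C x"] exI[of _ F]) (auto simp: algebra_simps)
  qed
  then show ?thesis using that r(1) by blast
qed

lemma cdim_zero: "cdim {0} = 0"
  using cdim_span_independent[OF finite.emptyI complex_vector.independent_empty]
  by (simp add: zero_enat_def)

lemma nullity_eq_0_iff:
  assumes "clinear S"
  shows "nullity S = 0 \<longleftrightarrow> inj S"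
proof
  assume "inj S"
  then have "null_space S = {0}"
    using clinear_0[OF assms] by (auto simp: null_space_def inj_def)
  then show "nullity S = 0"
    by (simp add: nullity_def cdim_zero)
next
  assume 0: "nullity S = 0"
  then have "fin_dim (null_space S)" by (simp add: nullity_def flip: cdim_finite_iff)
  then have "complex_vector.dim (null_space S) = 0"
    using 0 by (simp add: nullity_def cdim_fin_dim zero_enat_def)
  then have N: "{0} = null_space S"
    using \<open>fin_dim (null_space S)\<close> complex_vector.subspace_0[OF subspace_null_space[OF assms]]
    by (intro dim_eq_subspace_eq subspace_null_space assms) auto
  show "inj S"
  proof (rule injI)
    fix x y assume "S x = S y"
    then have "x - y \<in> null_space S" by (simp add: null_space_def clinear_diff[OF assms])
    then show "x = y" unfolding N[symmetric] by simp
  qed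
qed

lemma defect_eq_0_iff:
  assumes "clinear S"
  shows "defect S = 0 \<longleftrightarrow> surj S"
proof
  assume "surj S"
  have "codim (UNIV :: 'a set) = cdim {0 :: 'a}"
    by (rule codim_eq_cdim_complement) auto
  then show "defect S = 0"
    using \<open>surj S\<close> by (simp add: defect_def cdim_zero)
next
  assume 0: "defect S = 0"
  then have "codim (range S) < \<infinity>" by (simp add: defect_def)
  then obtain C where "finite C" "codim (range S) = enat (card C)"
    and *: "\<And>y. \<exists>m\<in>range S. \<exists>c\<in>complex_vector.span C. y = m + c"
    using codim_finite_complement[OF subspace_range[OF assms]] by metis
  then have "C = {}" using 0 by (simp add: defect_def zero_enat_def)
  then show "surj S" using * by auto
qed

lemma weyl_inj_iff_surj:
  fixes S :: "'a::complex_banach \<Rightarrow> 'a"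
  assumes "bounded_clinear S" "weyl S"
  shows "inj S \<longleftrightarrow> surj S"
  using nullity_eq_0_iff[OF bounded_clinear_clinear[OF assms(1)]] assms(2)
    defect_eq_0_iff[OF bounded_clinear_clinear[OF assms(1)]] weyl_iff[OF assms(1)] by simp

section \<open>Ascent and descent\<close>

lemma ascent_finite_iff: "ascent S < \<infinity> \<longleftrightarrow> (\<exists>p. null_space (S ^^ p) = null_space (S ^^ Suc p))"
  unfolding ascent_def by (simp split: if_split)

lemma descent_finite_iff: "descent S < \<infinity> \<longleftrightarrow> (\<exists>q. range (S ^^ q) = range (S ^^ Suc q))"
  unfolding descent_def by (simp split: if_split)

lemma null_space_funpow_stable:
  assumes "null_space (S ^^ p) = null_space (S ^^ Suc p)"
  shows "null_space (S ^^ (p + k)) = null_space (S ^^ p)"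
proof (induction k)
  case (Suc k)
  have "x \<in> null_space (S ^^ (p + Suc k)) \<longleftrightarrow> x \<in> null_space (S ^^ (p + k))" for x
  proof -
    have "x \<in> null_space (S ^^ (p + Suc k)) \<longleftrightarrow> (S ^^ k) x \<in> null_space (S ^^ Suc p)"
      using funpow_add[of "Suc p" k S] by (simp add: null_space_def)
    also have "\<dots> \<longleftrightarrow> (S ^^ k) x \<in> null_space (S ^^ p)" unfolding assms ..
    also have "\<dots> \<longleftrightarrow> x \<in> null_space (S ^^ (p + k))"
      by (simp add: null_space_def funpow_add)
    finally show ?thesis .
  qed
  then show ?case using Suc by blast
qed simp

lemma range_funpow_stable:
  fixes S :: "'a \<Rightarrow> 'a"
  assumes "range (S ^^ q) = range (S ^^ Suc q)"
  shows "range (S ^^ (q + k)) = range (S ^^ q)"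
proof (induction k)
  case (Suc k)
  have "range (S ^^ (q + Suc k)) = S ` range (S ^^ (q + k))" by (simp add: image_comp o_def)
  also have "\<dots> = S ` range (S ^^ q)" unfolding Suc ..
  also have "\<dots> = range (S ^^ Suc q)" by (simp add: image_comp o_def)
  finally show ?case using assms by simp
qed simp

lemma range_funpow_antimono:
  fixes S :: "'a \<Rightarrow> 'a"
  shows "m \<le> n \<Longrightarrow> range (S ^^ n) \<subseteq> range (S ^^ m)"
  by (auto simp: le_iff_add funpow_add)

lemma null_space_funpow_Suc_subset:
  assumes "clinear S"
  shows "null_space (S ^^ n) \<subseteq> null_space (S ^^ Suc n)"
  using clinear_0[OF assms] by (auto simp: null_space_def)

text \<open>
  The powers of \<open>S\<close> are Weyl. So \<open>dim N(S\<^sup>n) = dim N(S\<^sup>n\<^sup>+\<^sup>1)\<close> iff \<open>codim R(S\<^sup>n) = codim R(S\<^sup>n\<^sup>+\<^sup>1)\<close>,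
  and between nested spaces of finite dimension or codimension this decides equality.
\<close>

lemma weyl_ascent_finite_iff_descent_finite:
  fixes S :: "'a::complex_banach \<Rightarrow> 'a"
  assumes S: "bounded_clinear S" "weyl S"
  shows "ascent S < \<infinity> \<longleftrightarrow> descent S < \<infinity>"
proof -
  have lin: "clinear (S ^^ n)" for n by (rule clinear_funpow[OF bounded_clinear_clinear[OF S(1)]])
  have index: "nullity (S ^^ n) = defect (S ^^ n)" "nullity (S ^^ n) < \<infinity>" for n
    using weyl_funpow[OF S, of n] weyl_iff[OF bounded_clinear_funpow[OF S(1), of n]] by blast+
  have "null_space (S ^^ n) = null_space (S ^^ Suc n) \<longleftrightarrow> range (S ^^ n) = range (S ^^ Suc n)" for n
  proof
    assume "null_space (S ^^ n) = null_space (S ^^ Suc n)"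
    then have "defect (S ^^ Suc n) = defect (S ^^ n)"
      using index(1)[of n] index(1)[of "Suc n"] unfolding nullity_def by metis
    moreover have "defect (S ^^ n) < \<infinity>" using index[of n] by metis
    ultimately have "range (S ^^ Suc n) = range (S ^^ n)"
      unfolding defect_def
      by (intro codim_eq_subspace_eq[OF subspace_range[OF lin] subspace_range[OF lin]
            range_funpow_antimono[OF le_SucI[OF order_refl]]])
    then show "range (S ^^ n) = range (S ^^ Suc n)" ..
  next
    assume "range (S ^^ n) = range (S ^^ Suc n)"
    then have "nullity (S ^^ n) = nullity (S ^^ Suc n)"
      using index(1)[of n] index(1)[of "Suc n"] unfolding defect_def by metis
    with index(2)[of "Suc n"] show "null_space (S ^^ n) = null_space (S ^^ Suc n)"
      unfolding nullity_def
      by (rule cdim_eq_subspace_eq[OF subspace_null_space[OF lin] subspace_null_space[OF lin]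
            null_space_funpow_Suc_subset[OF bounded_clinear_clinear[OF S(1)]]])
  qed
  then show ?thesis unfolding ascent_finite_iff descent_finite_iff by blast
qed

lemma fin_dim_vimage:
  assumes S: "clinear S" and N: "fin_dim (null_space S)"
    and W: "complex_vector.subspace W" "fin_dim W"
  shows "fin_dim {x. S x \<in> W}"
proof -
  let ?span = "complex_vector.span"
  have "complex_vector.subspace (W \<inter> range S)"
    using W(1) subspace_range[OF S] by (rule complex_vector.subspace_inter)
  moreover have "fin_dim (W \<inter> range S)" using W(2) by (rule fin_dim_subset[rotated]) simp
  ultimately obtain D where D: "finite D" "?span D = W \<inter> range S"
    using fin_dim_basis by metis
  have "D \<subseteq> range S" using complex_vector.span_superset[of D] unfolding D(2) by simp
  then have "\<forall>d\<in>D. \<exists>x. S x = d" by blast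
  then obtain h where h: "\<And>d. d \<in> D \<Longrightarrow> S (h d) = d" by metis
  then have SD: "S ` ?span (h ` D) = ?span D"
    unfolding complex_pair.linear_span_image[OF S, symmetric] by (simp add: image_image)
  have "{x. S x \<in> W} \<subseteq> {u + v |u v. u \<in> null_space S \<and> v \<in> ?span (h ` D)}"
  proof
    fix x assume "x \<in> {x. S x \<in> W}"
    then have "S x \<in> S ` ?span (h ` D)" unfolding SD D(2) by simp
    then obtain v where v: "v \<in> ?span (h ` D)" "S x = S v" by blast
    then have "x - v \<in> null_space S" by (simp add: null_space_def clinear_diff[OF S])
    moreover have "x = (x - v) + v" by simp
    ultimately show "x \<in> {u + v |u v. u \<in> null_space S \<and> v \<in> ?span (h ` D)}" using v(1) by blast
  qed
  then show ?thesis
    using fin_dim_sum[OF N fin_dim_span[of "h ` D"]] D(1) by (meson fin_dim_subset finite_imageI)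
qed

lemma fin_dim_null_space_funpow:
  assumes S: "clinear S" and N: "fin_dim (null_space S)"
  shows "fin_dim (null_space (S ^^ n))"
proof (induction n)
  case 0
  have "null_space (S ^^ 0) = complex_vector.span {}" by (auto simp: null_space_def)
  then show ?case using fin_dim_span[OF finite.emptyI] by metis
next
  case (Suc n)
  have eq: "null_space (S ^^ Suc n) = {x. S x \<in> null_space (S ^^ n)}"
    by (simp add: null_space_def funpow_swap1)
  show ?case
    unfolding eq by (rule fin_dim_vimage[OF S N subspace_null_space[OF clinear_funpow[OF S]] Suc])
qed

text \<open>
  Positivity of \<open>n\<close> is imposed so that \<open>R(S\<^sup>n) \<subseteq> R(S)\<close>.
\<close>

lemma browder_stable_power:
  assumes "ascent S < \<infinity>" "descent S < \<infinity>"
  obtains n where "n > 0" "null_space (S ^^ Suc n) = null_space (S ^^ n)"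
    "\<And>k. range (S ^^ (n + k)) = range (S ^^ n)"
proof -
  obtain p q where p: "null_space (S ^^ p) = null_space (S ^^ Suc p)"
    and q: "range (S ^^ q) = range (S ^^ Suc q)"
    using assms ascent_finite_iff descent_finite_iff by metis
  define n where "n = Suc (p + q)"
  show ?thesis
  proof (rule that[of n])
    show "null_space (S ^^ Suc n) = null_space (S ^^ n)"
      using null_space_funpow_stable[OF p, of "Suc q"] null_space_funpow_stable[OF p, of "Suc (Suc q)"]
      by (simp add: n_def del: funpow.simps)
    show "range (S ^^ (n + k)) = range (S ^^ n)" for k
      using range_funpow_stable[OF q, of "Suc p"] range_funpow_stable[OF q, of "Suc (p + k)"]
      by (simp add: n_def add_ac del: funpow.simps)
  qed (simp add: n_def)
qed

text \<open>
  For \<open>n\<close> beyond ascent and descent, \<open>V = N(S\<^sup>n)\<close> is finite-dimensional, \<open>S x \<in> V\<close> iff \<open>x \<in> V\<close>, and the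
  space is \<open>V + R(S\<^sup>n)\<close>; so nullity and defect of \<open>S\<close> are those of its restriction to \<open>V\<close>.
\<close>

lemma browder_imp_weyl:
  fixes S :: "'a::complex_banach \<Rightarrow> 'a"
  assumes S: "bounded_clinear S" and br: "browder S"
  shows "weyl S"
proof -
  have lin: "clinear S" using S by (rule bounded_clinear_clinear)
  have N: "fin_dim (null_space S)"
    using br unfolding browder_def fredholm_def nullity_def cdim_finite_iff by blast
  obtain n where n: "n > 0" "null_space (S ^^ Suc n) = null_space (S ^^ n)"
    "\<And>k. range (S ^^ (n + k)) = range (S ^^ n)"
    using browder_stable_power[of S] br by (metis browder_def)
  define V where "V = null_space (S ^^ n)"
  have V: "complex_vector.subspace V" "fin_dim V"
    unfolding V_def by (rule subspace_null_space[OF clinear_funpow[OF lin]])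
      (rule fin_dim_null_space_funpow[OF lin N])
  have iff: "S x \<in> V \<longleftrightarrow> x \<in> V" for x
    unfolding V_def by (subst (2) n(2)[symmetric]) (simp add: null_space_def funpow_swap1)
  have sum: "\<exists>w\<in>V. \<exists>x. y = S x + w" for y
  proof -
    have "(S ^^ n) y \<in> range (S ^^ (n + n))" unfolding n(3) by blast
    then obtain z where z: "(S ^^ n) y = (S ^^ n) ((S ^^ n) z)" by (auto simp: funpow_add)
    then have "y - (S ^^ n) z \<in> V"
      by (simp add: V_def null_space_def clinear_diff[OF clinear_funpow[OF lin]])
    moreover obtain m where "n = Suc m" using n(1) gr0_implies_Suc by blast
    then have "y = S ((S ^^ m) z) + (y - (S ^^ n) z)" by simp
    ultimately show ?thesis by blast
  qed
  show ?thesis unfolding weyl_iff[OF S]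
    by (rule nullity_eq_defect_if_finite_part[OF lin V V refl iff sum])
qed

lemma subspace_real: "complex_vector.subspace V \<Longrightarrow> subspace V"
  unfolding complex_vector.subspace_def subspace_def by (simp add: scaleR_scaleC)

section \<open>Operators near a Browder or a Weyl operator\<close>

text \<open>
  For \<open>n\<close> beyond ascent and descent, \<open>M = R(S\<^sup>n)\<close> is closed and \<open>S\<close> maps it bijectively to itself, so
  \<open>norm x \<le> C * norm (S x)\<close> on \<open>M\<close> by the open mapping theorem. A solution of \<open>S x = c x\<close> with
  \<open>c \<noteq> 0\<close> is \<open>S\<^sup>n (x / c\<^sup>n)\<close> and thus lies in \<open>M\<close>; it vanishes if \<open>\<bar>c\<bar> C < 1\<close>. So \<open>S - c\<close> is injective,
  and for small \<open>c\<close> it is Weyl, hence bijective.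
\<close>

lemma browder_punctured_neighbourhood:
  fixes S :: "'a::complex_banach \<Rightarrow> 'a"
  assumes S: "bounded_clinear S" and br: "browder S"
  obtains r where "r > 0" "\<And>c. c \<noteq> 0 \<Longrightarrow> cmod c < r \<Longrightarrow> bij (\<lambda>x. S x - c *\<^sub>C x)"
proof -
  have lin: "clinear S" using S by (rule bounded_clinear_clinear)
  have weyl: "weyl S" using S br by (rule browder_imp_weyl)
  obtain n where n: "n > 0" "null_space (S ^^ Suc n) = null_space (S ^^ n)"
    "\<And>k. range (S ^^ (n + k)) = range (S ^^ n)"
    using browder_stable_power[of S] br by (metis browder_def)
  define M where "M = range (S ^^ n)"
  have "closed M"
    using weyl_funpow[OF S weyl, of n] by (simp add: M_def weyl_def fredholm_def)
  moreover have subM: "complex_vector.subspace M"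
    unfolding M_def by (rule subspace_range[OF clinear_funpow[OF lin]])
  moreover have "S ` M = M"
    using n(3)[of 1] by (simp add: M_def image_comp o_def)
  ultimately obtain C where C: "C > 0" "\<And>y. y \<in> M \<Longrightarrow> \<exists>x\<in>M. S x = y \<and> norm x \<le> C * norm y"
    using open_mapping_closed_subspaces[OF bounded_clinear_bounded_linear[OF S] subspace_real[OF subM]]
    by metis
  have inj_M: "x = 0" if "x \<in> M" "S x = 0" for x
  proof -
    obtain y where y: "x = (S ^^ n) y" using \<open>x \<in> M\<close> by (auto simp: M_def)
    then have "y \<in> null_space (S ^^ Suc n)" using \<open>S x = 0\<close> by (simp add: null_space_def)
    then have "y \<in> null_space (S ^^ n)" by (simp only: n(2))
    then show ?thesis by (simp add: y null_space_def)
  qed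
  obtain r where r: "r > 0" "\<And>c. cmod c < r \<Longrightarrow> weyl (\<lambda>x. S x - c *\<^sub>C x)"
    using weyl_perturbation[OF S weyl] by blast
  have "bij (\<lambda>x. S x - c *\<^sub>C x)" if c: "c \<noteq> 0" "cmod c < r" "cmod c < 1 / C" for c
  proof -
    have bcl: "bounded_clinear (\<lambda>x. S x - c *\<^sub>C x)" using S by (rule bounded_clinear_sub_scaleC)
    have kernel: "x = 0" if x: "S x = c *\<^sub>C x" for x
    proof -
      have "(S ^^ k) x = (c ^ k) *\<^sub>C x" for k
        by (induction k) (simp_all add: scaleC_one clinear_scale[OF lin] x scaleC_scaleC mult.commute)
      then have "(S ^^ n) ((1 / c ^ n) *\<^sub>C x) = x"
        using c(1) by (simp add: clinear_scale[OF clinear_funpow[OF lin]] scaleC_scaleC scaleC_one)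
      then have xM: "x \<in> M" unfolding M_def by (metis rangeI)
      then have "S x \<in> M" unfolding x by (rule complex_vector.subspace_scale[OF subM])
      then obtain z where z: "z \<in> M" "S z = S x" "norm z \<le> C * norm (S x)" using C(2) by blast
      have "z - x \<in> M" using z(1) xM by (rule complex_vector.subspace_diff[OF subM])
      moreover have "S (z - x) = 0" using z(2) by (simp add: clinear_diff[OF lin])
      ultimately have "z - x = 0" by (rule inj_M)
      then have "norm x \<le> C * cmod c * norm x" using z(3) x by (simp add: norm_scaleC mult.assoc)
      moreover have "C * cmod c < 1" using c(3) C(1) by (simp add: field_simps)
      ultimately show "x = 0"
        using mult_strict_right_mono[of "C * cmod c" 1 "norm x"] by (cases "x = 0") auto
    qed
    have "inj (\<lambda>x. S x - c *\<^sub>C x)"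
    proof (rule injI)
      fix x y assume eq: "S x - c *\<^sub>C x = S y - c *\<^sub>C y"
      have "S (x - y) - c *\<^sub>C (x - y) = (S x - c *\<^sub>C x) - (S y - c *\<^sub>C y)"
        by (simp add: clinear_diff[OF lin] complex_vector.scale_right_diff_distrib)
      then have "S (x - y) = c *\<^sub>C (x - y)" unfolding eq by simp
      then show "x = y" using kernel[of "x - y"] by simp
    qed
    then show ?thesis using weyl_inj_iff_surj[OF bcl r(2)[OF c(2)]] by (simp add: bij_def)
  qed
  then show ?thesis using that[of "min r (1 / C)"] r(1) C(1) by simp
qed

text \<open>
  Let \<open>E\<close> be the intersection of all \<open>R(S\<^sup>n)\<close>. The spaces \<open>N(S) \<inter> R(S\<^sup>n)\<close> are nonzero, as the ascent is
  infinite, and decreasing of finite dimension, hence eventually constant. So \<open>E\<close> contains a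
  nonzero \<open>x\<^sub>0 \<in> N(S)\<close>; moreover \<open>S\<close> maps \<open>E\<close> onto \<open>E\<close>. As \<open>E\<close> is closed, the open mapping theorem
  provides \<open>x\<^sub>k\<close> in \<open>E\<close> with \<open>S x\<^sub>k\<^sub>+\<^sub>1 = x\<^sub>k\<close> and \<open>norm x\<^sub>k \<le> C\<^sup>k norm x\<^sub>0\<close>, and \<open>\<Sum> c\<^sup>k x\<^sub>k\<close> is an eigenvector for
  every \<open>c\<close> with \<open>\<bar>c\<bar> < 1 / (2 C)\<close>.
\<close>

lemma infinite_ascent_imp_eigenvectors:
  fixes S :: "'a::complex_banach \<Rightarrow> 'a"
  assumes S: "bounded_clinear S" and weyl: "weyl S" and asc: "ascent S = \<infinity>"
  obtains r where "r > 0" "\<And>c. cmod c < r \<Longrightarrow> \<not> inj (\<lambda>x. S x - c *\<^sub>C x)"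
proof -
  have lin: "clinear S" using S by (rule bounded_clinear_clinear)
  have linN: "clinear (S ^^ n)" for n using lin by (rule clinear_funpow)
  have N: "fin_dim (null_space S)"
    using weyl unfolding weyl_def fredholm_def nullity_def cdim_finite_iff by blast
  define M where "M n = null_space S \<inter> range (S ^^ n)" for n
  have subM: "complex_vector.subspace (M n)" for n
    unfolding M_def using subspace_null_space[OF lin] subspace_range[OF linN] by (rule complex_vector.subspace_inter)
  obtain n0 where n0: "\<And>n. complex_vector.dim (M n0) \<le> complex_vector.dim (M n)"
    using ex_has_least_nat[of "\<lambda>_. True" _ "\<lambda>n. complex_vector.dim (M n)"] by blast
  have M_le: "M n \<subseteq> M m" if "m \<le> n" for m n using range_funpow_antimono[OF that, of S] by (auto simp: M_def)
  have M_const: "M n = M n0" if "n \<ge> n0" for n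
  proof (rule dim_eq_subspace_eq[OF subM subM M_le[OF that] _ n0])
    show "fin_dim (M n0)" using N by (rule fin_dim_subset[rotated]) (simp add: M_def)
  qed
  define E where "E = (\<Inter>n. range (S ^^ n))"
  have M_E: "M n0 \<subseteq> E"
  proof -
    have "M n0 \<subseteq> range (S ^^ n)" for n
      using M_const[of "max n n0"] M_le[of n "max n n0"] by (auto simp: M_def)
    then show ?thesis by (auto simp: E_def)
  qed
  have subE: "complex_vector.subspace E"
    unfolding E_def using subspace_range[OF linN] by (intro complex_vector.subspace_Int) blast
  have "closed (range (S ^^ n))" for n
    using weyl_funpow[OF S weyl, of n] by (simp add: weyl_def fredholm_def)
  then have closedE: "closed E" unfolding E_def by blast
  have SE: "S ` E = E"
  proof (rule antisym)
    show "S ` E \<subseteq> E"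
    proof (rule image_subsetI)
      fix x assume "x \<in> E"
      show "S x \<in> E" unfolding E_def
      proof
        fix n
        obtain z where "x = (S ^^ n) z" using \<open>x \<in> E\<close> by (auto simp: E_def)
        then have "S x = (S ^^ n) (S z)" by (simp add: funpow_swap1)
        then show "S x \<in> range (S ^^ n)" by blast
      qed
    qed
    show "E \<subseteq> S ` E"
    proof
      fix y assume y: "y \<in> E"
      have pre: "\<exists>z. y = S ((S ^^ n) z)" for n
      proof -
        have "y \<in> range (S ^^ Suc n)" using y unfolding E_def by blast
        then show ?thesis by auto
      qed
      \<comment> \<open>Two preimages of \<open>y\<close>, one in \<open>R(S\<^sup>n\<^sup>0)\<close> and one in a smaller range, differ by an element of
        \<open>N(S) \<inter> R(S\<^sup>n\<^sup>0)\<close>, which is contained in all ranges; so the first one is in all ranges, too.\<close>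
      obtain w where w: "y = S ((S ^^ n0) w)" using pre by blast
      have "(S ^^ n0) w \<in> range (S ^^ n)" for n
      proof -
        obtain z where z: "y = S ((S ^^ max n n0) z)" using pre by blast
        define d where "d = (S ^^ n0) w - (S ^^ max n n0) z"
        have 1: "range (S ^^ max n n0) \<subseteq> range (S ^^ n)" "range (S ^^ max n n0) \<subseteq> range (S ^^ n0)"
          by (simp_all add: range_funpow_antimono)
        then have "d \<in> range (S ^^ n0)"
          unfolding d_def by (intro complex_vector.subspace_diff[OF subspace_range[OF linN]]) auto
        moreover have "d \<in> null_space S" using w z by (simp add: d_def null_space_def clinear_diff[OF lin])
        ultimately have "d \<in> M n0" by (simp add: M_def)
        then have "d \<in> range (S ^^ n)" using M_E by (auto simp: E_def)
        moreover have "(S ^^ max n n0) z \<in> range (S ^^ n)" using 1(1) by blast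
        ultimately have "d + (S ^^ max n n0) z \<in> range (S ^^ n)"
          by (rule complex_vector.subspace_add[OF subspace_range[OF linN]])
        then show ?thesis by (simp add: d_def)
      qed
      then have "(S ^^ n0) w \<in> E" by (simp add: E_def)
      then show "y \<in> S ` E" using w by blast
    qed
  qed
  obtain C where C: "C > 0" "\<And>y. y \<in> E \<Longrightarrow> \<exists>x\<in>E. S x = y \<and> norm x \<le> C * norm y"
    using open_mapping_closed_subspaces[OF bounded_clinear_bounded_linear[OF S] subspace_real[OF subE]
        closedE closedE SE] by metis
  then obtain g where g: "\<And>y. y \<in> E \<Longrightarrow> g y \<in> E" "\<And>y. y \<in> E \<Longrightarrow> S (g y) = y"
    "\<And>y. y \<in> E \<Longrightarrow> norm (g y) \<le> C * norm y" by metis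
  have "null_space (S ^^ n0) \<noteq> null_space (S ^^ Suc n0)"
    using asc ascent_finite_iff[of S] by auto
  then obtain u where u: "u \<in> null_space (S ^^ Suc n0)" "u \<notin> null_space (S ^^ n0)"
    using null_space_funpow_Suc_subset[OF lin, of n0] by blast
  define x0 where "x0 = (S ^^ n0) u"
  have x0: "x0 \<noteq> 0" "S x0 = 0" using u by (simp_all add: x0_def null_space_def)
  then have "x0 \<in> M n0" by (simp add: M_def x0_def null_space_def)
  then have x0E: "x0 \<in> E" using M_E by blast
  define x where "x k = (g ^^ k) x0" for k
  have xE: "x k \<in> E" for k by (induction k) (simp_all add: x_def x0E g(1))
  have x_0: "x 0 = x0" and S_x: "S (x (Suc k)) = x k" for k
    using g(2)[OF xE[of k]] by (simp_all add: x_def)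
  have x_norm: "norm (x k) \<le> C ^ k * norm x0" for k
  proof (induction k)
    case (Suc k)
    have "norm (x (Suc k)) \<le> C * norm (x k)" using g(3)[OF xE[of k]] by (simp add: x_def)
    also have "\<dots> \<le> C * (C ^ k * norm x0)" using Suc C(1) by (intro mult_left_mono) auto
    finally show ?case by (simp add: mult.assoc)
  qed (simp add: x_0)
  have "\<not> inj (\<lambda>x. S x - c *\<^sub>C x)" if c: "cmod c < 1 / (2 * C)" for c
  proof -
    define q where "q = cmod c * C"
    have q: "0 \<le> q" "q < 1 / 2" using c C(1) by (simp_all add: q_def field_simps)
    define f where "f k = (c ^ k) *\<^sub>C x k" for k
    have f_norm: "norm (f k) \<le> norm x0 * q ^ k" for k
    proof -
      have "norm (f k) \<le> cmod c ^ k * (C ^ k * norm x0)"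
        unfolding f_def norm_scaleC norm_power by (intro mult_left_mono x_norm) simp
      then show ?thesis by (simp add: q_def power_mult_distrib mult_ac)
    qed
    have geo: "(\<lambda>k. norm x0 * q ^ k) sums (norm x0 * (1 / (1 - q)))"
      using q by (intro sums_mult geometric_sums) simp
    have sumn: "summable (\<lambda>k. norm (f k))"
      by (rule summable_comparison_test[OF _ sums_summable[OF geo]]) (use f_norm in auto)
    then have sumf: "summable f" by (rule summable_norm_cancel)
    then have sumf1: "summable (\<lambda>k. f (Suc k))" by (simp only: summable_Suc_iff)
    define v where "v = suminf f"
    have v_split: "v = x0 + (\<Sum>k. f (Suc k))"
      using suminf_split_head[OF sumf] by (simp add: v_def f_def x_0 scaleC_one)
    \<comment> \<open>The bound \<open>q < 1/2\<close> makes the tail \<open>q / (1 - q)\<close> of the geometric series less than \<open>1\<close>, so the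
      sum of the series is not \<open>0\<close>.\<close>
    have "norm (\<Sum>k. f (Suc k)) < norm x0"
    proof -
      have "(\<lambda>k. norm x0 * q * q ^ k) sums (norm x0 * q * (1 / (1 - q)))"
        using q by (intro sums_mult geometric_sums) simp
      moreover have "summable (\<lambda>k. norm (f (Suc k)))" using sumn by (subst summable_Suc_iff)
      moreover have "norm (f (Suc k)) \<le> norm x0 * q * q ^ k" for k
        using f_norm[of "Suc k"] by (simp add: mult_ac)
      ultimately have "(\<Sum>k. norm (f (Suc k))) \<le> norm x0 * q * (1 / (1 - q))"
        using sums_unique sums_summable suminf_le by metis
      moreover have "norm (\<Sum>k. f (Suc k)) \<le> (\<Sum>k. norm (f (Suc k)))"
        using \<open>summable (\<lambda>k. norm (f (Suc k)))\<close> by (rule summable_norm)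
      moreover have "norm x0 * q * (1 / (1 - q)) < norm x0 * 1"
        unfolding mult.assoc using q x0(1) by (intro mult_strict_left_mono) (auto simp: field_simps)
      ultimately show ?thesis by linarith
    qed
    then have v0: "v \<noteq> 0" unfolding v_split by (metis add_eq_0_iff less_irrefl norm_minus_cancel)
    have "S v = S x0 + S (\<Sum>k. f (Suc k))" unfolding v_split by (rule clinear_add[OF lin])
    also have "\<dots> = (\<Sum>k. S (f (Suc k)))"
      using x0(2) bounded_linear.suminf[OF bounded_clinear_bounded_linear[OF S] sumf1] by simp
    also have "\<dots> = (\<Sum>k. c *\<^sub>C f k)"
      by (simp add: f_def clinear_scale[OF lin] S_x scaleC_scaleC)
    also have "\<dots> = c *\<^sub>C v"
      unfolding v_def using bounded_linear.suminf[OF bounded_linear_scaleC sumf] by simp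
    finally have "S v - c *\<^sub>C v = S 0 - c *\<^sub>C 0" by (simp add: clinear_0[OF lin])
    then show ?thesis using v0 by (metis injD)
  qed
  then show ?thesis using that[of "1 / (2 * C)"] C(1) by simp
qed

lemma weyl_imp_browder_if_injective_nearby:
  fixes S :: "'a::complex_banach \<Rightarrow> 'a"
  assumes S: "bounded_clinear S" and weyl: "weyl S"
    and near: "\<And>r. r > 0 \<Longrightarrow> \<exists>c. cmod c < r \<and> inj (\<lambda>x. S x - c *\<^sub>C x)"
  shows "browder S"
proof -
  have "ascent S < \<infinity>"
  proof (rule ccontr)
    assume "\<not> ascent S < \<infinity>"
    then have "ascent S = \<infinity>" by simp
    then show False using infinite_ascent_imp_eigenvectors[OF S weyl] near by metis
  qed
  then show ?thesis
    using weyl weyl_ascent_finite_iff_descent_finite[OF S weyl] by (simp add: browder_def weyl_def)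
qed

section \<open>Browder's theorem and interiors of spectra\<close>

lemma shifted_shifted: "shifted T (l + c) = (\<lambda>x. shifted T l x - c *\<^sub>C x)"
  by (auto simp: shifted_def scaleC_add_left)

lemma bounded_clinear_shifted: "bounded_clinear T \<Longrightarrow> bounded_clinear (shifted T l)"
  unfolding shifted_def by (rule bounded_clinear_sub_scaleC)

lemma browders_theorem_holds_iff:
  fixes T :: "'a::complex_banach \<Rightarrow> 'a"
  assumes T: "bounded_clinear T"
  shows "browders_theorem_holds T \<longleftrightarrow> (\<forall>l. weyl (shifted T l) \<longrightarrow> browder (shifted T l))"
  using browder_imp_weyl[OF bounded_clinear_shifted[OF T]]
  unfolding browders_theorem_holds_def weyl_spectrum_def browder_spectrum_def by blast

lemma not_in_interior:
  assumes "l \<notin> interior X" "r > 0"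
  obtains c :: complex where "cmod c < r" "l + c \<notin> X"
proof -
  obtain z where "dist l z < r" "z \<notin> X"
    using assms unfolding mem_interior by (auto simp: subset_iff)
  then show ?thesis using that[of "z - l"] by (simp add: dist_norm norm_minus_commute)
qed

text \<open>
  Near a Browder point of \<open>T\<close> there are points outside \<open>X\<close>, because \<open>T - l\<close> is bijective there. So
  if Browder's theorem holds, no Weyl point is interior to \<open>X\<close>. Conversely, if no Weyl point is
  interior to \<open>X\<close>, each of them is a limit of Weyl points outside \<open>X\<close>, thus a limit of points with
  \<open>T - l\<close> injective, and at a Weyl point this enforces finite ascent and descent.
\<close>

lemma browders_theorem_iff_interior:
  fixes T :: "'a::complex_banach \<Rightarrow> 'a"
  assumes T: "bounded_clinear T"
    and bij: "\<And>l. bij (shifted T l) \<Longrightarrow> l \<notin> X"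
    and near: "\<And>l r. l \<notin> X \<Longrightarrow> weyl (shifted T l) \<Longrightarrow> r > 0 \<Longrightarrow>
      \<exists>c. cmod c < r \<and> inj (shifted T (l + c))"
  shows "browders_theorem_holds T \<longleftrightarrow> interior X \<subseteq> weyl_spectrum T"
  unfolding browders_theorem_holds_iff[OF T]
proof
  assume B: "\<forall>l. weyl (shifted T l) \<longrightarrow> browder (shifted T l)"
  show "interior X \<subseteq> weyl_spectrum T"
  proof (rule subsetI, rule ccontr)
    fix l assume l: "l \<in> interior X" "l \<notin> weyl_spectrum T"
    then have "browder (shifted T l)" using B by (simp add: weyl_spectrum_def)
    then obtain r where r: "r > 0" "\<And>c. c \<noteq> 0 \<Longrightarrow> cmod c < r \<Longrightarrow> bij (shifted T (l + c))"
      using browder_punctured_neighbourhood[OF bounded_clinear_shifted[OF T]] unfolding shifted_shifted by metis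
    obtain e where e: "e > 0" "ball l e \<subseteq> X" using l(1) unfolding mem_interior by blast
    define c where "c = complex_of_real (min r e / 2)"
    have "cmod c = min r e / 2" using r(1) e(1) unfolding c_def norm_of_real by simp
    then have c: "c \<noteq> 0" "cmod c < r" "cmod c < e" using r(1) e(1) by auto
    then have "l + c \<in> X" using e(2) by (auto simp: dist_norm)
    then show False using bij r(2)[OF c(1,2)] by blast
  qed
next
  assume sub: "interior X \<subseteq> weyl_spectrum T"
  show "\<forall>l. weyl (shifted T l) \<longrightarrow> browder (shifted T l)"
  proof (intro allI impI)
    fix l assume weyl: "weyl (shifted T l)"
    then have l: "l \<notin> interior X" using sub by (auto simp: weyl_spectrum_def)
    have bcl: "bounded_clinear (shifted T l)" using T by (rule bounded_clinear_shifted)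
    obtain r0 where r0: "r0 > 0" "\<And>c. cmod c < r0 \<Longrightarrow> weyl (shifted T (l + c))"
      using weyl_perturbation[OF bcl weyl] unfolding shifted_shifted by metis
    have "\<exists>c. cmod c < r \<and> inj (shifted T (l + c))" if r: "r > 0" for r
    proof -
      obtain c where c: "cmod c < min r0 (r / 2)" "l + c \<notin> X"
        using not_in_interior[OF l, of "min r0 (r / 2)"] r r0(1) by auto
      then have "weyl (shifted T (l + c))" using r0(2) by simp
      then obtain d where d: "cmod d < r / 2" "inj (shifted T (l + c + d))"
        using near[OF c(2), of "r / 2"] r by auto
      have "cmod (c + d) < r" using norm_triangle_ineq[of c d] c(1) d(1) by simp
      then show ?thesis using d(2) by (metis add.assoc)
    qed
    then show "browder (shifted T l)"
      using weyl_imp_browder_if_injective_nearby[OF bcl weyl] unfolding shifted_shifted by blast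
  qed
qed

text \<open>
  At a point outside the descent spectrum where \<open>T - l\<close> is Weyl, \<open>T - l\<close> is even Browder, and the
  injective operators are found in the punctured neighbourhood.
\<close>

theorem corollary3p1:
  fixes T :: "'a::complex_banach \<Rightarrow> 'a"
  assumes infinite_dim: "cdim (UNIV :: 'a set) = \<infinity>"
    and T: "bounded_clinear T"
  shows "(browders_theorem_holds T \<longleftrightarrow> interior (desc_spectrum T) \<subseteq> weyl_spectrum T) \<and>
         (browders_theorem_holds T \<longleftrightarrow> interior (su_spectrum T) \<subseteq> weyl_spectrum T) \<and>
         (browders_theorem_holds T \<longleftrightarrow> interior (ap_spectrum T) \<subseteq> weyl_spectrum T) \<and>
         (interior (ap_spectrum T) = {} \<or> interior (su_spectrum T) = {} \<longrightarrow>
            browders_theorem_holds T)"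
proof -
  have bcl: "bounded_clinear (shifted T l)" for l using T by (rule bounded_clinear_shifted)
  have self: "\<exists>c. cmod c < r \<and> inj (shifted T (l + c))" if "inj (shifted T l)" "r > 0" for l r
    using that by (intro exI[of _ 0]) simp
  have desc: "browders_theorem_holds T \<longleftrightarrow> interior (desc_spectrum T) \<subseteq> weyl_spectrum T"
  proof (rule browders_theorem_iff_interior[OF T])
    fix l assume "bij (shifted T l)"
    then have "range (shifted T l ^^ 0) = range (shifted T l ^^ Suc 0)" by (simp add: bij_def)
    then have "descent (shifted T l) < \<infinity>" unfolding descent_finite_iff by blast
    then show "l \<notin> desc_spectrum T" by (auto simp: desc_spectrum_def)
  next
    fix l and r :: real assume l: "l \<notin> desc_spectrum T" "weyl (shifted T l)" and r: "r > 0"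
    then have "descent (shifted T l) < \<infinity>" by (simp add: desc_spectrum_def)
    then have "browder (shifted T l)"
      using l(2) weyl_ascent_finite_iff_descent_finite[OF bcl l(2)] by (simp add: browder_def weyl_def)
    then obtain s where s: "s > 0" "\<And>c. c \<noteq> 0 \<Longrightarrow> cmod c < s \<Longrightarrow> bij (shifted T (l + c))"
      using browder_punctured_neighbourhood[OF bcl] unfolding shifted_shifted by metis
    define c where "c = complex_of_real (min r s / 2)"
    have "cmod c = min r s / 2" using r s(1) unfolding c_def norm_of_real by simp
    then have "c \<noteq> 0" "cmod c < r" "cmod c < s" using r s(1) by auto
    then show "\<exists>c. cmod c < r \<and> inj (shifted T (l + c))" using s(2) bij_is_inj by blast
  qed
  have su: "browders_theorem_holds T \<longleftrightarrow> interior (su_spectrum T) \<subseteq> weyl_spectrum T"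
  proof (rule browders_theorem_iff_interior[OF T])
    show "l \<notin> su_spectrum T" if "bij (shifted T l)" for l
      using that by (simp add: su_spectrum_def bij_def)
    fix l and r :: real assume "l \<notin> su_spectrum T" "weyl (shifted T l)" "r > 0"
    then show "\<exists>c. cmod c < r \<and> inj (shifted T (l + c))"
      using weyl_inj_iff_surj[OF bcl] by (intro self) (auto simp: su_spectrum_def)
  qed
  have ap: "browders_theorem_holds T \<longleftrightarrow> interior (ap_spectrum T) \<subseteq> weyl_spectrum T"
  proof (rule browders_theorem_iff_interior[OF T])
    show "l \<notin> ap_spectrum T" if "bij (shifted T l)" for l
      using that by (simp add: ap_spectrum_def bounded_below_op_def bij_def)
    fix l and r :: real assume "l \<notin> ap_spectrum T" "r > 0"
    then show "\<exists>c. cmod c < r \<and> inj (shifted T (l + c))"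
      by (intro self) (auto simp: ap_spectrum_def bounded_below_op_def)
  qed
  show ?thesis using desc su ap by auto
qed

end
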